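(* Let $n$ be an integer with $2\le n\le 34$ or $n=37$, and let $l>0$ be an integer. Given an equi-$n$-square and two sequences $(x^{(1)},\dots,x^{(l)})$ and $(y^{(1)},\dots,y^{(l)})$ of $l$ non-negative integers less than $n^n$, there is a sequence of $2l$ HV-shuffles with which the standard operation mode, started at the given equi-$n$-square, turns the first (input) sequence into the second (output) sequence.
   Context: The formal $n$-square is the set of $n^2$ positions $(k,r)$ with $0\le k,r<n$; $k$ is the column number and $r$ the row number. An equi-$n$-square is a function $P$ assigning to each position a digit in $\{0,\dots,n-1\}$ such that each digit is assigned to exactly $n$ positions. An H-move independently rotates each row: $(k,r)\mapsto (k+a_r \bmod n,\ r)$ for some integers $a_0,\dots,a_{n-1}$. A V-move independently rotates each column: $(k,r)\mapsto(k,\ r+b_k \bmod n)$ for some integers $b_0,\dots,b_{n-1}$. An HV-shuffle is an H-move followed by a V-move. Performing a shuffle $\sigma$ on an equi-$n$-square $P$ moves the cells with their content: the result $P'$ satisfies $P'(\sigma(p))=P(p)$ for all $p$. H-indirection in an equi-$n$-square $P$ transforms a non-negative integer $x<n^n$ with base-$n$ representation $(x_{n-1}\dots x_0)_n$ (leading zeros included) into the integer $y=(y_{n-1}\dots y_0)_n<n^n$, where $y_k=P(k,x_k)$ for $k=0,\dots,n-1$. The standard operation mode starts with an equi-$n$-square as current state and, for $t=1,\dots,l$ successively, (i) performs two HV-shuffles on the current state (giving the new current state), (ii) performs an H-indirection in the current state with the input integer $x^{(t)}$, and (iii) outputs the resulting integer. It turns the input sequence into the sequence of its $l$ outputs. 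*)

theory Defs
  imports Main
begin

definition square :: "nat \<Rightarrow> (nat \<times> nat) set" where
  "square n = {..<n} \<times> {..<n}"

text \<open>A position is a pair (column, row). Functions on the square are total functions on
  pairs of naturals, of which only the values on \<^term>\<open>square n\<close> matter.\<close>

definition equi_square :: "nat \<Rightarrow> (nat \<times> nat \<Rightarrow> nat) \<Rightarrow> bool" where
  "equi_square n P \<longleftrightarrow>
     (\<forall>p\<in>square n. P p < n) \<and> (\<forall>d<n. card {p \<in> square n. P p = d} = n)"

definition H_move :: "nat \<Rightarrow> (nat \<Rightarrow> int) \<Rightarrow> nat \<times> nat \<Rightarrow> nat \<times> nat" where
  "H_move n a = (\<lambda>(k, r). (nat ((int k + a r) mod int n), r))"

definition V_move :: "nat \<Rightarrow> (nat \<Rightarrow> int) \<Rightarrow> nat \<times> nat \<Rightarrow> nat \<times> nat" where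
  "V_move n b = (\<lambda>(k, r). (k, nat ((int r + b k) mod int n)))"

definition HV_shuffle :: "nat \<Rightarrow> (nat \<times> nat \<Rightarrow> nat \<times> nat) \<Rightarrow> bool" where
  "HV_shuffle n \<sigma> \<longleftrightarrow> (\<exists>a b. \<sigma> = V_move n b \<circ> H_move n a)"

text \<open>Cells move with their content; lemma \<open>perform_shuffle\<close> below gives the
  characteristic equation.\<close>

definition perform ::
  "nat \<Rightarrow> (nat \<times> nat \<Rightarrow> nat \<times> nat) \<Rightarrow> (nat \<times> nat \<Rightarrow> nat) \<Rightarrow> (nat \<times> nat \<Rightarrow> nat)" where
  "perform n \<sigma> P = (\<lambda>q. P (inv_into (square n) \<sigma> q))"

definition digit :: "nat \<Rightarrow> nat \<Rightarrow> nat \<Rightarrow> nat" where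
  "digit n x k = x div n ^ k mod n"

definition H_indirection :: "nat \<Rightarrow> (nat \<times> nat \<Rightarrow> nat) \<Rightarrow> nat \<Rightarrow> nat" where
  "H_indirection n P x = (\<Sum>k<n. P (k, digit n x k) * n ^ k)"

text \<open>The list of shuffles is consumed two at a time, one pair for each input. The last
  equation is only reached with a nonempty list of inputs if there are too few shuffles.\<close>

fun standard_mode ::
  "nat \<Rightarrow> (nat \<times> nat \<Rightarrow> nat) \<Rightarrow> (nat \<times> nat \<Rightarrow> nat \<times> nat) list \<Rightarrow> nat list \<Rightarrow> nat list" where
  "standard_mode n P (\<sigma> # \<tau> # \<sigma>s) (x # xs) =
     (let P' = perform n \<tau> (perform n \<sigma> P)
      in H_indirection n P' x # standard_mode n P' \<sigma>s xs)"
| "standard_mode n P _ _ = []"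

lemma rotate_inj:
  assumes "k < n" "k' < n" "(int k + c) mod int n = (int k' + c) mod int n"
  shows "k = k'"
proof -
  have "(int k + c - c) mod int n = (int k' + c - c) mod int n"
    using assms(3) by (metis mod_diff_left_eq)
  then show ?thesis using assms(1,2) by simp
qed

lemma bij_betw_H_move: "bij_betw (H_move n a) (square n) (square n)"
proof -
  have "inj_on (H_move n a) (square n)"
    by (auto simp: inj_on_def H_move_def square_def eq_nat_nat_iff dest: rotate_inj)
  moreover have "H_move n a ` square n \<subseteq> square n"
    by (auto simp: H_move_def square_def nat_less_iff)
  ultimately show ?thesis
    by (simp add: bij_betw_def endo_inj_surj square_def)
qed

lemma bij_betw_V_move: "bij_betw (V_move n b) (square n) (square n)"
proof -
  have "inj_on (V_move n b) (square n)"
    by (auto simp: inj_on_def V_move_def square_def eq_nat_nat_iff dest: rotate_inj)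
  moreover have "V_move n b ` square n \<subseteq> square n"
    by (auto simp: V_move_def square_def nat_less_iff)
  ultimately show ?thesis
    by (simp add: bij_betw_def endo_inj_surj square_def)
qed

lemma bij_betw_HV_shuffle:
  "HV_shuffle n \<sigma> \<Longrightarrow> bij_betw \<sigma> (square n) (square n)"
  by (auto simp: HV_shuffle_def intro: bij_betw_trans bij_betw_H_move bij_betw_V_move)

lemma perform_shuffle:
  "HV_shuffle n \<sigma> \<Longrightarrow> p \<in> square n \<Longrightarrow> perform n \<sigma> P (\<sigma> p) = P p"
  by (simp add: perform_def bij_betw_inv_into_left[OF bij_betw_HV_shuffle])

end

theory Submission
  imports Defs "HOL-Library.Code_Binary_Nat" "HOL-Library.Multiset" "HOL-Library.Disjoint_Sets"
begin

text \<open>Choose \<open>n\<close> cells that carry the digits of the wanted output. It is enough that the first shuffle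
  brings them into distinct rows: the second H-move then takes each of them to its own column, and
  the second V-move to the row addressed by the input.

  The first H-move is chosen such that few columns stay without a chosen cell. A row with \<open>a\<close> chosen
  cells can, by averaging over its rotations, be placed such that it reduces the number \<open>v\<close> of empty
  columns to at most \<open>\<lfloor>v (n - a) / n\<rfloor>\<close>, and the rows may be treated in any order. The subsequent V-move
  has to make the chosen cells of the columns disjoint as sets of rows; placing the columns greedily by
  decreasing size succeeds if there are at most \<open>(n + 3) / 4\<close> empty columns. A search through the
  partitions of \<open>n\<close> shows that this bound can be reached, or missed by just one in a few cases in
  which a closer look at the last columns to be placed shows that they still fit.\<close>

subsection \<open>Disjoint translates in the cyclic group\<close>

definition rot :: "nat \<Rightarrow> nat \<Rightarrow> nat set \<Rightarrow> nat set" where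
  "rot n t A = (\<lambda>x. (x + t) mod n) ` A"

lemma add_mod_inj:
  fixes n :: nat
  assumes "x < n" "y < n" "(x + t) mod n = (y + t) mod n"
  shows "x = y"
proof -
  have "(int x + int t) mod int n = (int y + int t) mod int n"
    using assms(3) by (metis of_nat_add of_nat_mod)
  then show ?thesis using assms rotate_inj by blast
qed

lemma inj_on_add_mod: "A \<subseteq> {..<n} \<Longrightarrow> inj_on (\<lambda>x. (x + t) mod n) A" for n :: nat
  by (meson add_mod_inj inj_onI lessThan_iff subsetD)

lemma card_rot: "A \<subseteq> {..<n} \<Longrightarrow> card (rot n t A) = card A"
  unfolding rot_def by (rule card_image[OF inj_on_add_mod])

lemma rot_subset: "A \<subseteq> {..<n} \<Longrightarrow> rot n t A \<subseteq> {..<n}"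
  by (cases "n = 0") (auto simp: rot_def)

lemma finite_rot: "finite A \<Longrightarrow> finite (rot n t A)"
  by (simp add: rot_def)

lemma card_shifts:
  fixes n :: nat
  assumes "x < n" "u < n"
  shows "card {t. t < n \<and> (x + t) mod n = u} = 1"
proof -
  let ?t = "(u + (n - x)) mod n"
  have "?t < n" using assms by simp
  moreover have "(x + ?t) mod n = u"
    using assms by (simp add: mod_add_right_eq)
  moreover have "t = ?t" if "t < n" "(x + t) mod n = u" for t
    using that calculation add_mod_inj[of t n ?t x] by (simp add: add.commute)
  ultimately have "{t. t < n \<and> (x + t) mod n = u} = {?t}" by blast
  then show ?thesis by simp
qed

text \<open>Double counting: each pair of a point of \<open>A\<close> and a point of
  \<open>U\<close> is matched by exactly one of the \<open>n\<close> rotations.\<close>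

lemma sum_card_rot_Int:
  assumes "A \<subseteq> {..<n}" "U \<subseteq> {..<n}"
  shows "(\<Sum>t<n. card (rot n t A \<inter> U)) = card A * card U"
proof -
  have fin: "finite A" "finite U" using assms finite_subset by blast+
  have "card (rot n t A \<inter> U) = (\<Sum>x\<in>A. \<Sum>u\<in>U. if (x + t) mod n = u then 1 else 0)" for t
  proof -
    have "rot n t A \<inter> U = (\<lambda>x. (x + t) mod n) ` {x \<in> A. (x + t) mod n \<in> U}"
      by (auto simp: rot_def)
    then have "card (rot n t A \<inter> U) = card {x \<in> A. (x + t) mod n \<in> U}"
      using assms(1) by (simp add: card_image inj_on_add_mod subset_iff)
    also have "\<dots> = (\<Sum>x\<in>A. if (x + t) mod n \<in> U then 1 else 0)"
      using fin by (simp add: sum.If_cases Int_def)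
    also have "\<dots> = (\<Sum>x\<in>A. \<Sum>u\<in>U. if (x + t) mod n = u then 1 else 0)"
      using fin by (intro sum.cong) auto
    finally show ?thesis .
  qed
  then have "(\<Sum>t<n. card (rot n t A \<inter> U))
      = (\<Sum>x\<in>A. \<Sum>u\<in>U. \<Sum>t<n. if (x + t) mod n = u then 1 else 0)"
    by (simp add: sum.swap[of _ _ "{..<n}"])
  also have "\<dots> = (\<Sum>x\<in>A. \<Sum>u\<in>U. 1)"
  proof (intro sum.cong refl)
    fix x u assume "x \<in> A" "u \<in> U"
    then have "card {t. t < n \<and> (x + t) mod n = u} = 1"
      using assms by (intro card_shifts) auto
    then show "(\<Sum>t<n. if (x + t) mod n = u then 1 else 0) = (1::nat)"
      by (simp add: sum.If_cases Int_def lessThan_def)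
  qed
  finally show ?thesis by simp
qed

lemma ex_small_overlap:
  assumes "A \<subseteq> {..<n}" "U \<subseteq> {..<n}" "n > 0"
  obtains t where "t < n" "n * card (rot n t A \<inter> U) \<le> card A * card U"
proof (rule ccontr)
  assume "\<not> thesis"
  then have "card A * card U < n * card (rot n t A \<inter> U)" if "t < n" for t
    using that \<open>\<not> thesis\<close> not_less \<open>\<And>t. t < n \<Longrightarrow> _ \<Longrightarrow> thesis\<close> by blast
  then have "(\<Sum>t<n. card A * card U) < (\<Sum>t<n. n * card (rot n t A \<inter> U))"
    using assms(3) by (intro sum_strict_mono) auto
  then show False
    using sum_card_rot_Int[OF assms(1,2)] by (simp add: sum_distrib_left[symmetric])
qed

text \<open>In the application \<open>B j\<close> is the set of rows occupied in column
  \<open>j\<close>, and \<open>s\<close> is the V-move that separates the columns.\<close>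

definition packable :: "nat \<Rightarrow> ('a \<Rightarrow> nat set) \<Rightarrow> 'a set \<Rightarrow> bool" where
  "packable n B J \<longleftrightarrow> (\<exists>s. disjoint_family_on (\<lambda>j. rot n (s j) (B j)) J)"

lemma card_UN_rot:
  assumes "finite J" "\<And>j. j \<in> J \<Longrightarrow> B j \<subseteq> {..<n}" "disjoint_family_on (\<lambda>j. rot n (s j) (B j)) J"
  shows "card (\<Union>j\<in>J. rot n (s j) (B j)) = (\<Sum>j\<in>J. card (B j))"
proof -
  have "card (\<Union>j\<in>J. rot n (s j) (B j)) = (\<Sum>j\<in>J. card (rot n (s j) (B j)))"
    using assms by (intro card_UN_disjoint')
      (auto intro: finite_rot finite_subset)
  then show ?thesis using assms by (simp add: card_rot)
qed

lemma disjoint_family_extend: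
  assumes "disjoint_family_on (\<lambda>j. rot n (s j) (B j)) K" "j \<notin> K"
    and "rot n t (B j) \<inter> (\<Union>k\<in>K. rot n (s k) (B k)) = {}"
  shows "disjoint_family_on (\<lambda>i. rot n ((s(j := t)) i) (B i)) (insert j K)"
  using assms unfolding disjoint_family_on_def by auto

text \<open>Translates of the sets placed earlier occupy \<open>\<Sum>card\<close> points, and each of them excludes
  at most \<open>card (B j)\<close> positions of the set to be placed next.\<close>

lemma packable_greedy_from:
  assumes "finite J" "n > 0" "\<And>j. j \<in> J \<Longrightarrow> B j \<subseteq> {..<n}"
    and "I \<subseteq> J" "disjoint_family_on (\<lambda>j. rot n (s j) (B j)) I"
    and "\<And>j K. j \<in> J - I \<Longrightarrow> I \<subseteq> K \<Longrightarrow> K \<subseteq> J - {j} \<Longrightarrow>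
           (\<And>k. k \<in> K - I \<Longrightarrow> card (B j) \<le> card (B k)) \<Longrightarrow>
           card (B j) * (\<Sum>k\<in>K. card (B k)) < n"
  shows "\<exists>s'. (\<forall>i\<in>I. s' i = s i) \<and> disjoint_family_on (\<lambda>j. rot n (s' j) (B j)) J"
  using assms(1,3-)
proof (induction "card (J - I)" arbitrary: J)
  case 0
  then have "J = I" by auto
  then show ?case using 0 by auto
next
  case (Suc m)
  have "J - I \<noteq> {}" using Suc.hyps(2) by (metis card.empty nat.distinct(1))
  \<comment> \<open>The smallest set outside \<open>I\<close> is placed last: the induction
    hypothesis applies to \<open>J - {j}\<close>, and minimality supplies the size condition on the
    sets already placed.\<close>
  define j where "j = arg_min_on (\<lambda>k. card (B k)) (J - I)"
  have j: "j \<in> J - I" "\<And>k. k \<in> J - I \<Longrightarrow> card (B j) \<le> card (B k)"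
    using arg_min_if_finite(1)[of "J - I" "\<lambda>k. card (B k)"] arg_min_least[of "J - I" _ "\<lambda>k. card (B k)"]
      Suc.prems(1) \<open>J - I \<noteq> {}\<close> by (auto simp: j_def)
  have "J - {j} - I = J - I - {j}" by auto
  then have "m = card (J - {j} - I)"
    using Suc.hyps(2) j(1) Suc.prems(1) by (simp add: card_Diff_singleton)
  then obtain s' where s': "\<forall>i\<in>I. s' i = s i" "disjoint_family_on (\<lambda>j. rot n (s' j) (B j)) (J - {j})"
    using Suc.hyps(1)[of "J - {j}"] Suc.prems j(1) by (auto simp: subset_iff)
  let ?U = "\<Union>k\<in>J - {j}. rot n (s' k) (B k)"
  have "card ?U = (\<Sum>k\<in>J - {j}. card (B k))"
    using Suc.prems s' by (intro card_UN_rot) auto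
  then have less: "card (B j) * card ?U < n"
    using Suc.prems(5)[of j "J - {j}"] j Suc.prems(3) by auto
  have "?U \<subseteq> {..<n}" using Suc.prems(2) rot_subset by (intro UN_least) blast
  moreover have "B j \<subseteq> {..<n}" using j(1) Suc.prems(2) by auto
  ultimately obtain t where "n * card (rot n t (B j) \<inter> ?U) \<le> card (B j) * card ?U"
    using ex_small_overlap \<open>n > 0\<close> by metis
  then have "n * card (rot n t (B j) \<inter> ?U) < n * 1" using less by linarith
  then have "card (rot n t (B j) \<inter> ?U) < 1" by (simp only: mult_less_cancel1)
  then have "card (rot n t (B j) \<inter> ?U) = 0" by simp
  moreover have "finite (rot n t (B j) \<inter> ?U)"
    using \<open>?U \<subseteq> {..<n}\<close> finite_subset by blast
  ultimately have "disjoint_family_on (\<lambda>i. rot n ((s'(j := t)) i) (B i)) (insert j (J - {j}))"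
    using s'(2) by (intro disjoint_family_extend) auto
  moreover have "insert j (J - {j}) = J" using j(1) by auto
  moreover have "\<forall>i\<in>I. (s'(j := t)) i = s i" using j(1) s'(1) by auto
  ultimately show ?case by metis
qed

section \<open>Packing of pairs and singletons\<close>

lemma rot_rot: "rot n s (rot n t A) = rot n (s + t) A"
  by (simp add: rot_def image_image mod_add_left_eq add.assoc add.commute[of t s])

lemma rot_mod: "rot n (t mod n) A = rot n t A"
  by (simp add: rot_def mod_add_right_eq)

lemma rot_add_self: "rot n (t + n) A = rot n t A"
  by (simp add: rot_def add.assoc[symmetric])

lemma pair_eq_rot:
  assumes "B \<subseteq> {..<n}" "card B = 2"
  obtains x e where "x < n" "0 < e" "e < n" "B = rot n x {0, e}"
proof -
  obtain p q where pq: "B = {p, q}" "p < q"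
    using assms(2) by (metis card_2_iff insert_commute linorder_neqE_nat)
  then have "q < n" using assms(1) by auto
  then show thesis using that[of p "q - p"] pq by (simp add: rot_def)
qed

text \<open>If \<open>d\<close> is the distance of one of the two pairs, up to sign modulo
  \<open>n\<close>, any disjoint placement works, and one exists because \<open>2 * 2 < n\<close>.
  Otherwise a translate of \<open>{0, d}\<close> has to join a point of the first pair to a point of
  the second, and three ways of doing this cannot all fail.\<close>

lemma ex_disjoint_pair_linked:
  assumes "4 < n" "0 < a" "a < n" "0 < b" "b < n" "0 < d" "d < n"
  shows "\<exists>s t. rot n s {0, b} \<inter> {0, a} = {} \<and> rot n t {0, d} \<subseteq> {0, a} \<union> rot n s {0, b}"
proof -
  have rot_pair: "rot n t {0, e} = {t mod n, (e + t) mod n}" for t e by (simp add: rot_def)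
  have "card {0, b} * card {0, a} < n" using assms by simp
  moreover obtain s where "n * card (rot n s {0, b} \<inter> {0, a}) \<le> card {0, b} * card {0, a}"
    using ex_small_overlap[of "{0, b}" n "{0, a}"] assms by auto
  ultimately have "n * card (rot n s {0, b} \<inter> {0, a}) < n * 1" by linarith
  then have s: "rot n s {0, b} \<inter> {0, a} = {}" by (auto simp: finite_rot)
  consider "d = a" | "d + a = n" | "d = b" | "d + b = n"
    | "d \<noteq> a" "d + a \<noteq> n" "d \<noteq> b" "d + b \<noteq> n" by blast
  then show ?thesis
  proof cases
    case 1
    then show ?thesis using s assms by (intro exI[of _ s] exI[of _ 0]) (auto simp: rot_pair)
  next
    case 2
    then show ?thesis using s assms by (intro exI[of _ s] exI[of _ a]) (auto simp: rot_pair)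
  next
    case 3
    then show ?thesis using s by auto
  next
    case 4
    then have "(d + (b + s)) mod n = s mod n" by (simp add: add.assoc[symmetric])
    then have "rot n (b + s) {0, d} \<subseteq> rot n s {0, b}" by (simp add: rot_pair)
    then show ?thesis using s by blast
  next
    case 5
    have m: "x mod n = (if x < n then x else x - n)" if "x < 2 * n" for x
      using that by (auto simp: mod_if)
    have small: "a mod n = a" "d mod n = d" "(n - d) mod n = n - d" using assms by simp_all
    have bd: "(b + d) mod n = (if b + d < n then b + d else b + d - n)"
      and bnd: "(b + (n - d)) mod n = (if b + (n - d) < n then b + (n - d) else b + (n - d) - n)"
      and ad: "(a + d) mod n = (if a + d < n then a + d else a + d - n)"
      and bb: "(b + b) mod n = (if b + b < n then b + b else b + b - n)"
      using assms by (intro m; simp)+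
    have bd0: "(b + d) mod n \<noteq> 0" unfolding bd using 5 assms by simp
    \<comment> \<open>The second pair is rotated by \<open>d\<close>, \<open>n - d\<close> or
      \<open>a + d\<close>, which puts one of its points at distance \<open>d\<close> from
      \<open>0\<close> or from \<open>a\<close>. Under the exclusions made, each choice fails only
      if its other point hits the first pair as listed.\<close>
    consider "(b + d) mod n \<noteq> a" | "(b + (n - d)) mod n \<noteq> a" | "(b + (a + d)) mod n \<noteq> 0"
      | "(b + d) mod n = a" "(b + (n - d)) mod n = a" "(b + (a + d)) mod n = 0" by blast
    then show ?thesis
    proof cases
      case 1
      have "rot n d {0, b} \<inter> {0, a} = {}"
        using 1 5 assms bd0 by (simp add: rot_pair small)
      moreover have "rot n 0 {0, d} \<subseteq> {0, a} \<union> rot n d {0, b}"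
        by (simp add: rot_pair small)
      ultimately show ?thesis by blast
    next
      case 2
      have "(b + (n - d)) mod n \<noteq> 0" unfolding bnd using 5 assms by (cases "b < d") simp_all
      then have "rot n (n - d) {0, b} \<inter> {0, a} = {}"
        using 2 5 assms by (simp add: rot_pair small)
      moreover have "rot n (n - d) {0, d} \<subseteq> {0, a} \<union> rot n (n - d) {0, b}"
        using assms by (simp add: rot_pair small)
      ultimately show ?thesis by blast
    next
      case 3
      have "(b + (a + d)) mod n \<noteq> a"
      proof
        assume "(b + (a + d)) mod n = a"
        then have "((b + d) mod n + a) mod n = (0 + a) mod n"
          using assms by (simp add: mod_add_left_eq mod_add_right_eq ac_simps)
        then have "(b + d) mod n = 0"
          using assms add_mod_inj[of "(b + d) mod n" n 0 a] by simp
        then show False using bd0 by simp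
      qed
      moreover have "(a + d) mod n \<noteq> 0" "(a + d) mod n \<noteq> a"
        unfolding ad using 5 assms by (simp, cases "a + d < n", simp_all)
      ultimately have "rot n (a + d) {0, b} \<inter> {0, a} = {}"
        using 3 by (simp add: rot_pair)
      moreover have "rot n a {0, d} \<subseteq> {0, a} \<union> rot n (a + d) {0, b}"
        by (simp add: rot_pair small add.commute)
      ultimately show ?thesis by blast
    next
      case 4
      \<comment> \<open>If all three choices fail, the first two equations give
        \<open>2 * d = n\<close>, and then the third gives \<open>2 * b = n\<close>. So
        \<open>d = b\<close>, which is excluded.\<close>
      have "2 * d = n"
      proof (rule ccontr)
        assume "2 * d \<noteq> n"
        then show False using 4(1,2) assms unfolding bd bnd by (simp split: if_splits)
      qed
      moreover have "(b + (a + d)) mod n = (b + (b + d + d)) mod n"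
        unfolding 4(1)[symmetric] by (metis mod_add_left_eq mod_add_right_eq)
      ultimately have "(b + b) mod n = 0" using 4(3)
        by (metis add.assoc mod_add_self2 mult_2)
      then have "2 * b = n" using assms unfolding bb by (simp split: if_splits)
      then show ?thesis using \<open>2 * d = n\<close> 5 by simp
    qed
  qed
qed

text \<open>A singleton is blocked only by occupied points, and since the sizes add up to at most
  \<open>n\<close>, fewer than \<open>n\<close> points are occupied while a singleton is still
  waiting.\<close>

lemma packable_singletons_from:
  assumes "finite J" "n > 0" "\<And>j. j \<in> J \<Longrightarrow> B j \<subseteq> {..<n}"
    and "(\<Sum>j\<in>J. card (B j)) \<le> n"
    and "I \<subseteq> J" "disjoint_family_on (\<lambda>j. rot n (s j) (B j)) I" "\<And>j. j \<in> J - I \<Longrightarrow> card (B j) = 1"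
  shows "packable n B J"
proof -
  have "card (B j) * (\<Sum>k\<in>K. card (B k)) < n" if "j \<in> J - I" "K \<subseteq> J - {j}" for j K
  proof -
    have "(\<Sum>k\<in>K. card (B k)) \<le> (\<Sum>k\<in>J - {j}. card (B k))"
      using that assms(1) by (intro sum_mono2) auto
    also have "\<dots> < (\<Sum>k\<in>J. card (B k))"
      using that assms(1,7) by (simp add: sum.remove[of J j])
    finally show ?thesis using that assms(4,7) by simp
  qed
  then have "\<exists>s'. (\<forall>i\<in>I. s' i = s i) \<and> disjoint_family_on (\<lambda>j. rot n (s' j) (B j)) J"
    by (intro packable_greedy_from[OF assms(1,2,3,5,6)])
  then show ?thesis unfolding packable_def by metis
qed

text \<open>Greedy packing of \<open>n div 4 + 1\<close> pairs fails at most for the last pair, and only if every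
  translate of it meets the union of the others in exactly one point. This is excluded by placing the
  first two pairs such that their union contains a translate of the last pair.\<close>

lemma packable_pairs:
  assumes "finite J" "\<And>j. j \<in> J \<Longrightarrow> B j \<subseteq> {..<n}"
    and "(\<Sum>j\<in>J. card (B j)) \<le> n" "\<And>j. j \<in> J \<Longrightarrow> card (B j) = 1 \<or> card (B j) = 2"
    and "card {j \<in> J. card (B j) = 2} = d" "n = 4 * (d - 1)" "3 \<le> d"
  shows "packable n B J"
proof -
  let ?P = "{j \<in> J. card (B j) = 2}"
  have n: "4 < n" using assms(6,7) by simp
  have finP: "finite ?P" using assms(1) by simp
  obtain T where "T \<subseteq> ?P" "card T = 3" using obtain_subset_with_card_n[of 3 ?P] assms(5,7) by auto
  then obtain i1 i2 i3 where i: "i1 \<in> ?P" "i2 \<in> ?P" "i3 \<in> ?P" "i1 \<noteq> i2" "i1 \<noteq> i3" "i2 \<noteq> i3"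
    by (auto simp: card_3_iff)
  obtain x1 e1 where e1: "x1 < n" "0 < e1" "e1 < n" "B i1 = rot n x1 {0, e1}"
    using pair_eq_rot[of "B i1" n] i(1) assms(2) by auto
  obtain x2 e2 where e2: "x2 < n" "0 < e2" "e2 < n" "B i2 = rot n x2 {0, e2}"
    using pair_eq_rot[of "B i2" n] i(2) assms(2) by auto
  obtain x3 e3 where e3: "x3 < n" "0 < e3" "e3 < n" "B i3 = rot n x3 {0, e3}"
    using pair_eq_rot[of "B i3" n] i(3) assms(2) by auto
  obtain s2 t where st: "rot n s2 {0, e2} \<inter> {0, e1} = {}" "rot n t {0, e3} \<subseteq> {0, e1} \<union> rot n s2 {0, e2}"
    using ex_disjoint_pair_linked[OF n e1(2,3) e2(2,3) e3(2,3)] by auto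
  have shift_back: "rot n (s + (n - x)) (rot n x X) = rot n s X" if "x < n" for s x X
    using that rot_add_self[of n s X] by (simp add: rot_rot)
  have "rot n 0 {0, e1} = {0, e1}" using e1 by (simp add: rot_def)
  \<comment> \<open>Rotation by \<open>n - x\<close> undoes \<open>rot n x\<close>, so
    \<open>i1\<close> lands on \<open>{0, e1}\<close> and \<open>i2\<close> on
    \<open>rot n s2 {0, e2}\<close>.\<close>
  define s where "s = (\<lambda>j. if j = i1 then n - x1 else s2 + (n - x2))"
  have s1: "rot n (s i1) (B i1) = {0, e1}" "rot n (s i2) (B i2) = rot n s2 {0, e2}"
    using shift_back[OF e1(1), of 0 "{0, e1}"] shift_back[OF e2(1), of s2 "{0, e2}"] i(4) \<open>rot n 0 {0, e1} = {0, e1}\<close>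
    by (simp_all add: s_def e1(4) e2(4))
  then have disj: "disjoint_family_on (\<lambda>j. rot n (s j) (B j)) {i1, i2}"
    using st(1) i(4) by (auto simp: disjoint_family_on_def)
  let ?I = "?P - {i3}"
  have "\<exists>s'. (\<forall>i\<in>{i1, i2}. s' i = s i) \<and> disjoint_family_on (\<lambda>j. rot n (s' j) (B j)) ?I"
  proof (rule packable_greedy_from[OF _ _ _ _ disj])
    \<comment> \<open>Besides \<open>j\<close>, the pair \<open>i3\<close> is missing from
      \<open>K\<close> as well. So at most \<open>d - 2\<close> pairs are in place, and
      \<open>4 * (d - 2) < n\<close>.\<close>
    fix j K assume K: "j \<in> ?I - {i1, i2}" "K \<subseteq> ?I - {j}"
    then have "card K \<le> card (?P - {i3, j})"
      using finP by (intro card_mono) auto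
    also have "\<dots> = card ?P - card {i3, j}" using K(1) i(3) by (intro card_Diff_subset) auto
    also have "\<dots> = d - 2" using K(1) assms(5) by auto
    finally have "card K \<le> d - 2" .
    moreover have "(\<Sum>k\<in>K. card (B k)) = (\<Sum>k\<in>K. 2)" using K(2) by (intro sum.cong) auto
    ultimately show "card (B j) * (\<Sum>k\<in>K. card (B k)) < n" using K(1) assms(6,7) by auto
  qed (use i finP n assms(2) in auto)
  then obtain s' where s': "s' i1 = s i1" "s' i2 = s i2"
    "disjoint_family_on (\<lambda>j. rot n (s' j) (B j)) ?I" by auto
  define U where "U = (\<Union>j\<in>?I. rot n (s' j) (B j))"
  have "card U = (\<Sum>j\<in>?I. card (B j))"
    unfolding U_def using finP assms(2) s'(3) by (intro card_UN_rot) auto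
  also have "\<dots> = (\<Sum>j\<in>?I. 2)" by (intro sum.cong) auto
  also have "\<dots> = 2 * (d - 1)" using assms(5) i(3) finP by (simp add: card_Diff_singleton)
  finally have cardU: "card U = 2 * (d - 1)" .
  have B3: "B i3 \<subseteq> {..<n}" "card (B i3) = 2" using i(3) assms(2) by auto
  have U: "U \<subseteq> {..<n}" unfolding U_def using assms(2) rot_subset by (intro UN_least) blast
  let ?y = "\<lambda>u. card (rot n u (B i3) \<inter> U)"
  obtain t3 where t3: "t3 < n" "rot n t3 (B i3) \<subseteq> U"
  proof
    let ?t3 = "(t + (n - x3)) mod n"
    show "?t3 < n" using n by simp
    have "rot n ?t3 (B i3) = rot n t {0, e3}"
      using shift_back[OF e3(1), of t "{0, e3}"] by (simp add: rot_mod e3(4))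
    also have "\<dots> \<subseteq> rot n (s' i1) (B i1) \<union> rot n (s' i2) (B i2)" using st(2) s1 s'(1,2) by simp
    also have "\<dots> \<subseteq> U" unfolding U_def using i by auto
    finally show "rot n ?t3 (B i3) \<subseteq> U" .
  qed
  \<comment> \<open>The overlaps with \<open>U\<close> have average exactly 1, since
    \<open>2 * (2 * (d - 1)) = n\<close>. As the rotation \<open>t3\<close> has overlap 2, some
    other one has overlap 0.\<close>
  have "\<exists>u<n. ?y u = 0"
  proof (rule ccontr)
    assume "\<not> ?thesis"
    then have ge: "1 \<le> ?y u" if "u < n" for u using that by (meson less_one not_less)
    have "?y t3 = 2" using t3 B3 by (simp add: Int_absorb2 card_rot)
    then have "\<exists>u\<in>{..<n}. 1 < ?y u" using t3(1) by (intro bexI[of _ t3]) auto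
    then have "(\<Sum>u<n. 1) < (\<Sum>u<n. ?y u)"
      using ge by (intro sum_strict_mono_ex1) auto
    also have "\<dots> = 2 * (2 * (d - 1))" using sum_card_rot_Int[OF B3(1) U] by (simp add: cardU B3(2))
    finally show False using assms(6) by simp
  qed
  then obtain u where "rot n u (B i3) \<inter> U = {}"
    using U finite_subset by (metis card_0_eq finite_Int finite_lessThan)
  then have "disjoint_family_on (\<lambda>j. rot n ((s'(i3 := u)) j) (B j)) (insert i3 ?I)"
    using s'(3) by (intro disjoint_family_extend) (auto simp: U_def)
  moreover have "insert i3 ?I = ?P" using i(3) by auto
  ultimately have "disjoint_family_on (\<lambda>j. rot n ((s'(i3 := u)) j) (B j)) ?P" by simp
  then show ?thesis
    using assms(1-4) n by (intro packable_singletons_from[of J n B ?P "s'(i3 := u)"]) auto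
qed

section \<open>A numerical criterion for packing\<close>

text \<open>Since the sizes add up to \<open>n\<close>, \<open>d\<close> is the total excess of the
  sizes over 1. In \<open>arith\<close>, \<open>s\<close> is the size of the next set,
  \<open>k\<close> the number of earlier sets and \<open>e\<close> their excess, so these occupy
  \<open>e + k\<close> points. Sets of size 2 are handled by \<open>mass\<close>, singletons by the
  total. The exception in \<open>arith\<close> means that at most \<open>h\<close> sets, all of size
  at least 3, use up the whole excess; \<open>spread\<close> rules this out.\<close>

lemma packable_criterion:
  assumes "finite J" "n > 0" "\<And>j. j \<in> J \<Longrightarrow> B j \<subseteq> {..<n}" "\<And>j. j \<in> J \<Longrightarrow> B j \<noteq> {}"
    and sum_card: "(\<Sum>j\<in>J. card (B j)) = n" and "card J + d = n"
    and mass: "2 * (\<Sum>j | j \<in> J \<and> 2 \<le> card (B j). card (B j)) < n + 4"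
    and arith: "\<And>s e k. 3 \<le> s \<Longrightarrow> k * (s - 1) \<le> e \<Longrightarrow> e + (s - 1) \<le> d \<Longrightarrow>
      s * (e + k) < n \<or> e + (s - 1) = d \<and> k < h"
    and spread: "h = 0 \<or> h < card {j \<in> J. 2 \<le> card (B j)} \<or> (\<exists>j\<in>J. card (B j) = 2)"
  shows "packable n B J"
proof -
  have "card (B j) * (\<Sum>k\<in>K. card (B k)) < n"
    if j: "j \<in> J" and K: "K \<subseteq> J - {j}" and le: "\<And>k. k \<in> K \<Longrightarrow> card (B j) \<le> card (B k)" for j K
  proof -
    let ?s = "card (B j)" and ?H = "{j \<in> J. 2 \<le> card (B j)}"
    have fin: "finite K" using K assms(1) finite_subset by blast
    have pos: "1 \<le> card (B i)" if "i \<in> J" for i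
    proof -
      have "finite (B i)" using assms(3)[OF that] finite_subset by blast
      then have "0 < card (B i)" using assms(4)[OF that] by (simp add: card_gt_0_iff)
      then show ?thesis by simp
    qed
    have sum_excess: "(\<Sum>i\<in>X. card (B i)) = (\<Sum>i\<in>X. card (B i) - 1) + card X" if "X \<subseteq> J" for X
    proof -
      have "(\<Sum>i\<in>X. card (B i)) = (\<Sum>i\<in>X. (card (B i) - 1) + 1)"
        using pos that by (intro sum.cong) fastforce+
      then show ?thesis by (simp only: sum.distrib card_eq_sum)
    qed
    have J: "J = insert j K \<union> (J - insert j K)" "insert j K \<inter> (J - insert j K) = {}" "j \<notin> K"
      using j K by auto
    have excess_J: "(\<Sum>i\<in>J. card (B i) - 1) = d"
      using sum_excess[of J] sum_card assms(6) by simp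
    also have "(\<Sum>i\<in>J. card (B i) - 1)
        = (\<Sum>i\<in>insert j K. card (B i) - 1) + (\<Sum>i\<in>J - insert j K. card (B i) - 1)"
      using fin assms(1) J by (metis finite_Diff finite_insert sum.union_disjoint)
    finally have total: "(?s - 1) + (\<Sum>i\<in>K. card (B i) - 1) + (\<Sum>i\<in>J - insert j K. card (B i) - 1) = d"
      using fin J(3) by simp
    define e where "e = (\<Sum>i\<in>K. card (B i) - 1)"
    have sum_K: "(\<Sum>k\<in>K. card (B k)) = e + card K" using sum_excess[of K] K by (auto simp: e_def)
    consider "?s = 1" | "?s = 2" | "3 \<le> ?s" using pos[OF j] by linarith
    then show ?thesis
    proof cases
      case 1
      have "(\<Sum>k\<in>K. card (B k)) + 1 \<le> (\<Sum>k\<in>insert j K. card (B k))"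
        using fin J(3) 1 by simp
      also have "\<dots> \<le> (\<Sum>k\<in>J. card (B k))" using assms(1) j K by (intro sum_mono2) auto
      finally show ?thesis using 1 sum_card by simp
    next
      case 2
      have "(\<Sum>k\<in>K. card (B k)) + 2 = (\<Sum>k\<in>insert j K. card (B k))"
        using fin J(3) 2 by simp
      also have "\<dots> \<le> (\<Sum>k\<in>?H. card (B k))"
        using assms(1) j K le 2 by (intro sum_mono2) auto
      finally show ?thesis using 2 mass by simp
    next
      case 3
      have "card K * (?s - 1) \<le> e"
        unfolding e_def using sum_bounded_below[of K "?s - 1" "\<lambda>i. card (B i) - 1"] le
        by (simp add: diff_le_mono)
      moreover have "e + (?s - 1) \<le> d" using total by (simp add: e_def)
      ultimately consider "?s * (e + card K) < n" | "e + (?s - 1) = d" "card K < h"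
        using arith[OF 3] by blast
      then show ?thesis
      proof cases
        case 1
        then show ?thesis by (simp add: sum_K)
      next
        case 2
        \<comment> \<open>No excess is left for the remaining sets, so they are singletons, and all
          sets of size at least 2 belong to \<open>insert j K\<close>, whose members have size at
          least 3.\<close>
        then have "(\<Sum>i\<in>J - insert j K. card (B i) - 1) = 0" using total by (simp add: e_def)
        then have one: "card (B i) \<le> 1" if "i \<in> J - insert j K" for i
          using that assms(1) by simp
        have three: "3 \<le> card (B i)" if "i \<in> insert j K" for i
          using that le 3 by fastforce
        have "\<nexists>i. i \<in> J \<and> card (B i) = 2"
        proof
          assume "\<exists>i. i \<in> J \<and> card (B i) = 2"
          then obtain i where "i \<in> J" "card (B i) = 2" by blast
          then show False using one[of i] three[of i] by fastforce
        qed
        moreover have "?H \<subseteq> insert j K" using one by fastforce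
        then have "card ?H \<le> card (insert j K)" using fin by (intro card_mono) auto
        then have "card ?H \<le> h" using 2(2) fin J(3) by simp
        ultimately show ?thesis using spread 2(2) by auto
      qed
    qed
  qed
  then have "\<exists>s'. (\<forall>i\<in>{}. s' i = (\<lambda>_. 0) i) \<and> disjoint_family_on (\<lambda>j. rot n (s' j) (B j)) J"
    by (intro packable_greedy_from assms(1-3)) (auto simp: disjoint_family_on_def)
  then show ?thesis unfolding packable_def by blast
qed

text \<open>Each set of size \<open>c\<close> is compared with twice its excess:
  \<open>c \<le> 2 * (c - 1)\<close> for \<open>c = 2\<close>, and even
  \<open>c + 1 \<le> 2 * (c - 1)\<close> from \<open>c = 3\<close> on.\<close>

lemma heavy_mass_le:
  assumes "finite J" "\<And>j. j \<in> J \<Longrightarrow> 1 \<le> card (B j)"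
    and "(\<Sum>j\<in>J. card (B j)) = n" "card J + d = n"
  shows "(\<Sum>j | j \<in> J \<and> 2 \<le> card (B j). card (B j)) + card {j \<in> J. 3 \<le> card (B j)} \<le> 2 * d"
proof -
  let ?c = "\<lambda>j. card (B j)"
  have "(\<Sum>j | j \<in> J \<and> 2 \<le> ?c j. ?c j) + card {j \<in> J. 3 \<le> ?c j}
      = (\<Sum>j\<in>J. (if 2 \<le> ?c j then ?c j else 0) + (if 3 \<le> ?c j then 1 else 0))"
    using assms(1) by (simp add: sum.distrib sum.inter_filter[symmetric])
  also have "\<dots> \<le> (\<Sum>j\<in>J. 2 * (?c j - 1))"
    using assms(2) by (intro sum_mono) auto
  also have "\<dots> + 2 * card J = (\<Sum>j\<in>J. 2 * ?c j)"
  proof -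
    have "(\<Sum>j\<in>J. 2 * (?c j - 1)) + 2 * card J = (\<Sum>j\<in>J. 2 * (?c j - 1) + 2)"
      by (simp only: sum.distrib sum_constant) simp
    also have "\<dots> = (\<Sum>j\<in>J. 2 * ?c j)" using assms(2) by (intro sum.cong) fastforce+
    finally show ?thesis .
  qed
  finally show ?thesis using assms(3,4) by (simp add: sum_distrib_left[symmetric])
qed

text \<open>The worst \<open>k\<close> is \<open>e div (s - 1)\<close>, and
  \<open>d \<le> 10\<close> leaves finitely many \<open>s\<close> and \<open>e\<close>. For these
  the product is at most \<open>4 * (e + (s - 1)) - 4\<close>, hence at most
  \<open>4 * d - 4\<close>, which is below \<open>n\<close>.\<close>

lemma arith_regular:
  fixes s e k d n :: nat
  assumes "d \<le> 10" "4 * d < n + 4" "3 \<le> s" "k * (s - 1) \<le> e" "e + (s - 1) \<le> d"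
  shows "s * (e + k) < n"
proof -
  have "\<forall>s\<in>set [3, 4, 5, 6, 7, 8, 9, 10, 11::nat]. \<forall>e\<in>set [0, 1, 2, 3, 4, 5, 6, 7, 8].
      if e + (s - 1) \<le> 10 then s * (e + e div (s - 1)) + 4 \<le> 4 * (e + (s - 1)) else True"
    by code_simp
  moreover have "s \<in> set [3, 4, 5, 6, 7, 8, 9, 10, 11]" "e \<in> set [0, 1, 2, 3, 4, 5, 6, 7, 8]"
    using assms(1,3,5) by auto
  ultimately have "if e + (s - 1) \<le> 10 then s * (e + e div (s - 1)) + 4 \<le> 4 * (e + (s - 1)) else True"
    by blast
  then have "s * (e + e div (s - 1)) + 4 \<le> 4 * (e + (s - 1))" using assms(1,5) by simp
  moreover have "k \<le> e div (s - 1)" using assms(3,4) by (simp add: less_eq_div_iff_mult_less_eq)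
  then have "s * (e + k) \<le> s * (e + e div (s - 1))" by simp
  ultimately have "s * (e + k) + 4 \<le> 4 * (e + (s - 1))" by (meson add_le_mono1 le_trans)
  also have "\<dots> \<le> 4 * d" using assms(5) by simp
  finally show ?thesis using assms(2) by linarith
qed

text \<open>A finite check as well, since \<open>d \<le> 9\<close>. The entries with
  \<open>h = 0\<close> satisfy the greedy estimate throughout; for the others it may fail only when
  at most \<open>h\<close> sets use up the whole excess.\<close>

lemma arith_exceptional:
  fixes s e k d n :: nat
  assumes "(n, d, h) \<in> set [(20, 6, 0), (24, 7, 0), (28, 8, 0), (27, 8, 4), (30, 9, 4), (31, 9, 3), (32, 9, 3)]"
    and "3 \<le> s" "k * (s - 1) \<le> e" "e + (s - 1) \<le> d"
  shows "s * (e + k) < n \<or> e + (s - 1) = d \<and> k < h"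
proof -
  let ?P = "\<lambda>n d (h::nat) s e. if e + (s - 1) \<le> d then
      if s * (e + e div (s - 1)) < n then True else e + (s - 1) = d \<and> e div (s - 1) < h else True"
  have "\<forall>(n, d, h)\<in>set [(20, 6, 0), (24, 7, 0), (28, 8, 0), (27, 8, 4), (30, 9, 4), (31, 9, 3), (32, 9, 3)].
      \<forall>s\<in>set [3, 4, 5, 6, 7, 8, 9, 10]. \<forall>e\<in>set [0, 1, 2, 3, 4, 5, 6, 7]. ?P n d h s e"
    by code_simp
  from bspec[OF this assms(1)] have "\<forall>s\<in>set [3, 4, 5, 6, 7, 8, 9, 10]. \<forall>e\<in>set [0, 1, 2, 3, 4, 5, 6, 7]. ?P n d h s e"
    by (simp only: prod.case)
  moreover have "d \<le> 9" using assms(1) by auto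
  then have "3 \<le> s \<and> s \<le> 10" "e \<le> 7" using assms(2,4) by linarith+
  then have "s \<in> set [3, 4, 5, 6, 7, 8, 9, 10]" "e \<in> set [0, 1, 2, 3, 4, 5, 6, 7]" by auto
  ultimately have "?P n d h s e" by blast
  then have "s * (e + e div (s - 1)) < n \<or> e + (s - 1) = d \<and> e div (s - 1) < h"
    using assms(4) by (simp only: if_True if_bool_eq_conj simp_thms) blast
  moreover have k: "k \<le> e div (s - 1)" using assms(2,3) by (simp add: less_eq_div_iff_mult_less_eq)
  then have "s * (e + k) \<le> s * (e + e div (s - 1))" by simp
  ultimately show ?thesis using k by linarith
qed

subsection \<open>Covering columns by rotated rows\<close>

definition squeeze :: "nat \<Rightarrow> nat \<Rightarrow> nat \<Rightarrow> nat" where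
  "squeeze n a v = v * (n - a) div n"

definition squeezes :: "nat \<Rightarrow> nat list \<Rightarrow> nat" where
  "squeezes n as = fold (squeeze n) as n"

lemma squeeze_mono: "v \<le> w \<Longrightarrow> squeeze n a v \<le> squeeze n a w"
  by (simp add: squeeze_def div_le_mono)

lemma squeezes_snoc: "squeezes n (as @ [a]) = squeeze n a (squeezes n as)"
  by (simp add: squeezes_def)

text \<open>\<open>A r\<close> holds the columns of the chosen cells in row \<open>r\<close>. Below,
  \<open>R\<close> is a set of rows and \<open>t r\<close> is the rotation of row \<open>r\<close>
  in the first H-move.\<close>

locale row_family =
  fixes n :: nat and A :: "nat \<Rightarrow> nat set"
  assumes n_pos: "n > 0" and A_subset: "A r \<subseteq> {..<n}"
begin

definition column :: "nat set \<Rightarrow> (nat \<Rightarrow> nat) \<Rightarrow> nat \<Rightarrow> nat set" where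
  "column R t j = {r \<in> R. j \<in> rot n (t r) (A r)}"

definition covered :: "nat set \<Rightarrow> (nat \<Rightarrow> nat) \<Rightarrow> nat set" where
  "covered R t = {j. column R t j \<noteq> {}}"

definition heavy :: "nat set \<Rightarrow> (nat \<Rightarrow> nat) \<Rightarrow> nat set" where
  "heavy R t = {j. 2 \<le> card (column R t j)}"

definition gap :: "nat set \<Rightarrow> (nat \<Rightarrow> nat) \<Rightarrow> nat" where
  "gap R t = n - card (covered R t)"

lemma covered_eq: "covered R t = (\<Union>r\<in>R. rot n (t r) (A r))"
  by (auto simp: covered_def column_def)

lemma covered_subset: "covered R t \<subseteq> {..<n}"
  using rot_subset[OF A_subset] by (fastforce simp: covered_eq)

lemma finite_covered [simp]: "finite (covered R t)"
  using covered_subset finite_subset by blast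

lemma card_covered_le: "card (covered R t) \<le> n"
  using card_mono[OF _ covered_subset] by simp

lemma card_covered: "card (covered R t) = n - gap R t"
  using card_covered_le[of R t] by (simp add: gap_def)

lemma gap_le: "gap R t \<le> n"
  by (simp add: gap_def)

lemma column_subset: "column R t j \<subseteq> R"
  by (auto simp: column_def)

lemma finite_column: "finite R \<Longrightarrow> finite (column R t j)"
  by (simp add: column_def)

lemma finite_A [simp]: "finite (A r)"
  using A_subset finite_subset by blast

lemma card_A_le: "card (A r) \<le> n"
  using card_mono[OF _ A_subset[of r]] by simp

lemma heavy_subset: "heavy R t \<subseteq> covered R t"
  by (auto simp: heavy_def covered_def)

lemma column_update: "r \<notin> R \<Longrightarrow>
    column (insert r R) (t(r := s)) j = (if j \<in> rot n s (A r) then insert r (column R t j) else column R t j)"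
  by (auto simp: column_def)

lemma covered_update:
  assumes "r \<notin> R"
  shows "covered (insert r R) (t(r := s)) = covered R t \<union> rot n s (A r)"
proof -
  have "(\<Union>i\<in>R. rot n ((t(r := s)) i) (A i)) = (\<Union>i\<in>R. rot n (t i) (A i))"
    using assms by (intro SUP_cong) auto
  then show ?thesis unfolding covered_eq by auto
qed

lemma gap_update:
  assumes "r \<notin> R"
  shows "gap (insert r R) (t(r := s)) + card (A r) = gap R t + card (rot n s (A r) \<inter> covered R t)"
proof -
  have "card (covered R t \<union> rot n s (A r)) + card (covered R t \<inter> rot n s (A r)) = card (covered R t) + card (A r)"
    using card_Un_Int[of "covered R t" "rot n s (A r)"] A_subset by (simp add: finite_rot card_rot)
  then show ?thesis
    using card_covered_le[of R t] card_covered_le[of "insert r R" "t(r := s)"]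
    by (simp add: gap_def covered_update[OF assms] Int_commute)
qed

text \<open>With \<open>a\<close> cells in the row and \<open>v\<close> empty columns before, a
  rotation of at most average overlap leaves at most
  \<open>v - a + a * (n - v) / n = v * (n - a) / n\<close> of them empty.\<close>

lemma ex_gap_insert_le:
  assumes "r \<notin> R"
  obtains s where "s < n" "gap (insert r R) (t(r := s)) \<le> squeeze n (card (A r)) (gap R t)"
proof -
  obtain s where s: "s < n" "n * card (rot n s (A r) \<inter> covered R t) \<le> card (A r) * card (covered R t)"
    using ex_small_overlap[OF A_subset covered_subset n_pos] by metis
  have e1: "int (gap (insert r R) (t(r := s))) =
      int (gap R t) + int (card (rot n s (A r) \<inter> covered R t)) - int (card (A r))"
    using gap_update[OF assms, of t s] by linarith
  have e2: "int n * int (card (rot n s (A r) \<inter> covered R t)) \<le> int (card (A r)) * (int n - int (gap R t))"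
    using s(2) gap_le[of R t] unfolding card_covered by (metis of_nat_diff of_nat_le_iff of_nat_mult)
  have "int n * int (gap (insert r R) (t(r := s))) \<le> int (gap R t) * (int n - int (card (A r)))"
    unfolding e1 using e2 by (simp add: algebra_simps)
  then have "n * gap (insert r R) (t(r := s)) \<le> gap R t * (n - card (A r))"
    using card_A_le[of r] by (metis of_nat_diff of_nat_le_iff of_nat_mult)
  then have "gap (insert r R) (t(r := s)) \<le> squeeze n (card (A r)) (gap R t)"
    using n_pos by (simp add: squeeze_def less_eq_div_iff_mult_less_eq mult.commute)
  with s(1) show thesis by (rule that)
qed

lemma ex_gap_le:
  assumes "distinct rs"
  shows "\<exists>t. gap (set rs) t \<le> squeezes n (map (\<lambda>r. card (A r)) rs)"
  using assms
proof (induction rs rule: rev_induct)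
  case Nil
  then show ?case by (simp add: squeezes_def gap_le)
next
  case (snoc r rs)
  then obtain t where t: "gap (set rs) t \<le> squeezes n (map (\<lambda>r. card (A r)) rs)"
    by (metis distinct_append)
  obtain s where "gap (insert r (set rs)) (t(r := s)) \<le> squeeze n (card (A r)) (gap (set rs) t)"
    using ex_gap_insert_le[of r "set rs" t] snoc.prems by auto
  also have "\<dots> \<le> squeeze n (card (A r)) (squeezes n (map (\<lambda>r. card (A r)) rs))"
    using t by (rule squeeze_mono)
  finally show ?case by (auto simp: squeezes_snoc)
qed

lemma sum_card_column:
  assumes "finite R" "finite X"
  shows "(\<Sum>j\<in>X. card (column R t j)) = (\<Sum>r\<in>R. card (rot n (t r) (A r) \<inter> X))"
proof -
  have "(\<Sum>j\<in>X. card (column R t j)) = (\<Sum>j\<in>X. \<Sum>r\<in>R. if j \<in> rot n (t r) (A r) then 1 else 0)"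
    using assms by (simp add: column_def sum.If_cases Int_def)
  also have "\<dots> = (\<Sum>r\<in>R. \<Sum>j\<in>X. if j \<in> rot n (t r) (A r) then 1 else 0)"
    by (rule sum.swap)
  also have "\<dots> = (\<Sum>r\<in>R. card (rot n (t r) (A r) \<inter> X))"
    using assms by (simp add: sum.If_cases Int_def conj_commute)
  finally show ?thesis .
qed

lemma sum_card_column_covered:
  assumes "finite R"
  shows "(\<Sum>j\<in>covered R t. card (column R t j)) = (\<Sum>r\<in>R. card (A r))"
proof -
  have "rot n (t r) (A r) \<inter> covered R t = rot n (t r) (A r)" if "r \<in> R" for r
    using that by (auto simp: covered_eq)
  then show ?thesis
    using sum_card_column[OF assms finite_covered] by (simp add: card_rot A_subset)
qed

text \<open>This turns the overlap of a row with the other rows, which local optimality controls,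
  into the share of that row in the heavy columns.\<close>

lemma rot_Int_heavy:
  assumes "finite R" "r \<in> R"
  shows "rot n (t r) (A r) \<inter> heavy R t = rot n (t r) (A r) \<inter> covered (R - {r}) t"
proof -
  have "2 \<le> card (column R t j) \<longleftrightarrow> column (R - {r}) t j \<noteq> {}" if "j \<in> rot n (t r) (A r)" for j
  proof -
    have "column R t j = insert r (column (R - {r}) t j)" "r \<notin> column (R - {r}) t j"
      using that assms(2) by (auto simp: column_def)
    moreover have "finite (column (R - {r}) t j)"
      using assms(1) by (simp add: finite_column)
    ultimately have "card (column R t j) = Suc (card (column (R - {r}) t j))"
      "card (column (R - {r}) t j) = 0 \<longleftrightarrow> column (R - {r}) t j = {}"
      by (metis card_insert_disjoint, metis card_0_eq)
    then show ?thesis by (metis One_nat_def Suc_1 Suc_le_mono le_zero_eq not_less_eq_eq)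
  qed
  then show ?thesis by (auto simp: heavy_def covered_def)
qed

text \<open>In a position minimising the number of empty columns no single row can be moved to
  advantage, so no row meets the others more often than it does on average.\<close>

lemma heavy_part_le:
  assumes "\<And>t. d \<le> gap R t" "gap R t = d" "finite R" "r \<in> R" "d > 0"
  shows "card (rot n (t r) (A r) \<inter> heavy R t) \<le> card (A r) * (n - d - card (A r)) div (n - card (A r))"
proof -
  let ?R = "R - {r}" and ?a = "card (A r)"
  let ?y = "card (rot n (t r) (A r) \<inter> covered ?R t)"
  have R: "insert r ?R = R" "r \<notin> ?R" using assms(4) by auto
  obtain s where s: "n * card (rot n s (A r) \<inter> covered ?R t) \<le> ?a * card (covered ?R t)"
    using ex_small_overlap[OF A_subset covered_subset n_pos] by metis
  have g: "d + ?a = gap ?R t + ?y"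
    using gap_update[OF R(2), of t "t r"] R(1) assms(2) by simp
  \<comment> \<open>Optimality: moving row \<open>r\<close> alone to the rotation \<open>s\<close>
    cannot leave fewer than \<open>d\<close> empty columns.\<close>
  have "d + ?a \<le> gap ?R t + card (rot n s (A r) \<inter> covered ?R t)"
    using gap_update[OF R(2), of t s] R(1) assms(1)[of "t(r := s)"] by simp
  then have "?y \<le> card (rot n s (A r) \<inter> covered ?R t)" using g by simp
  then have "n * ?y \<le> ?a * card (covered ?R t)"
    using s by (meson le_trans mult_le_mono2)
  \<comment> \<open>The number of columns covered by the other rows depends on \<open>?y\<close>
    itself; solving for \<open>?y\<close> produces the denominator
    \<open>n - card (A r)\<close>.\<close>
  moreover have "int (card (covered ?R t)) = int n - int d - int ?a + int ?y"
    using g gap_le[of ?R t] by (simp add: card_covered)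
  ultimately have *: "int n * int ?y \<le> int ?a * (int n - int d - int ?a + int ?y)"
    by (metis of_nat_le_iff of_nat_mult)
  have "?y \<le> card (rot n (t r) (A r))"
    by (intro card_mono) (simp_all add: finite_rot)
  then have y_le: "?y \<le> ?a" by (simp add: card_rot A_subset)
  have "rot n (t r) (A r) \<subseteq> covered R t" using assms(4) by (auto simp: covered_eq)
  then have "?a \<le> n - d"
    using card_mono[OF finite_covered] assms(2) by (metis card_rot[OF A_subset] card_covered)
  then have "int (n - d - ?a) = int n - int d - int ?a" "?a < n"
    using assms(2,5) n_pos gap_le[of R t] by linarith+
  then have "int ?y * int (n - ?a) \<le> int ?a * int (n - d - ?a)"
    using * by (simp add: algebra_simps of_nat_diff)
  then have "?y * (n - ?a) \<le> ?a * (n - d - ?a)" by (metis of_nat_le_iff of_nat_mult)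
  then have "?y \<le> ?a * (n - d - ?a) div (n - ?a)"
    using \<open>?a < n\<close> by (subst less_eq_div_iff_mult_less_eq) simp_all
  then show ?thesis by (simp only: rot_Int_heavy[OF assms(3,4)])
qed

text \<open>The average bound shows that the last row can attain the minimum \<open>d\<close>. The
  columns it shares with the others become heavy, which suffices if there are more than
  \<open>h\<close> of them. Otherwise there are so many optimal rotations that either more than
  \<open>h\<close> columns were heavy before, or some optimal rotation hits a column with a single
  cell and makes it a pair.\<close>

lemma ex_last_shift:
  assumes "finite R" "r \<notin> R" "\<And>t. d \<le> gap (insert r R) t"
    and "gap R t \<le> v" "squeeze n (card (A r)) v \<le> d"
    and cond: "h < d + card (A r) - v \<or>
      card (A r) * h < (d + card (A r) - v) * (n * (d + 1) - (n - card (A r)) * v)"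
  obtains s where "gap (insert r R) (t(r := s)) = d"
    and "h < card (heavy (insert r R) (t(r := s))) \<or> (\<exists>j. card (column (insert r R) (t(r := s)) j) = 2)"
proof -
  define a where "a = card (A r)"
  define U where "U = covered R t"
  define y where "y s = card (rot n s (A r) \<inter> U)" for s
  \<comment> \<open>\<open>f\<close> is the overlap that leaves exactly \<open>d\<close> empty
    columns, hence the least possible one, and \<open>G\<close> consists of the rotations attaining
    it.\<close>
  define f where "f = d + a - gap R t"
  define G where "G = {s. s < n \<and> y s = f}"
  let ?t = "\<lambda>s. t(r := s)"
  have gap_y: "gap (insert r R) (?t s) + a = gap R t + y s" for s
    using gap_update[OF assms(2)] by (simp add: a_def y_def U_def)
  have gap_ge: "d + a \<le> gap R t + y s" for s
    using gap_y[of s] assms(3)[of "?t s"] by linarith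
  obtain s0 where "s0 < n" "gap (insert r R) (?t s0) \<le> squeeze n a (gap R t)"
    using ex_gap_insert_le[OF assms(2)] unfolding a_def by metis
  then have "gap (insert r R) (?t s0) \<le> d"
    using squeeze_mono[OF assms(4), of n a] assms(5) by (simp add: a_def)
  then have d_eq: "d + a = gap R t + f" and "s0 \<in> G"
    using gap_ge[of s0] gap_y[of s0] \<open>s0 < n\<close> by (simp_all add: f_def G_def)
  have f_le: "f \<le> y s" for s using gap_ge[of s] d_eq by linarith
  have gap_G: "gap (insert r R) (?t s) = d" if "s \<in> G" for s
    using that gap_y[of s] d_eq by (simp add: G_def)
  have fU: "finite U" by (simp add: U_def)
  have heavy_Int: "rot n s (A r) \<inter> U \<subseteq> heavy (insert r R) (?t s)" for s
  proof
    fix j assume "j \<in> rot n s (A r) \<inter> U"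
    then have "column (insert r R) (?t s) j = insert r (column R t j)" "column R t j \<noteq> {}"
      using column_update[OF assms(2)] by (auto simp: U_def covered_def)
    moreover have "r \<notin> column R t j" using assms(2) column_subset by blast
    moreover have "finite (column R t j)" using assms(1) by (rule finite_column)
    ultimately show "j \<in> heavy (insert r R) (?t s)"
      by (simp add: heavy_def Suc_le_eq card_gt_0_iff)
  qed
  have fin_heavy: "finite (heavy (insert r R) t')" for t'
    using heavy_subset finite_covered finite_subset by blast
  have f_le_heavy: "f \<le> card (heavy (insert r R) (?t s))" for s
    using f_le[of s] card_mono[OF fin_heavy heavy_Int, of s] by (simp add: y_def)
  have f_ge: "d + a - v \<le> f" using assms(4) by (simp add: f_def)
  show thesis
  proof (cases "h < f")
    case True
    then show thesis using that[OF gap_G[OF \<open>s0 \<in> G\<close>]] f_le_heavy[of s0] by auto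
  next
    case False
    then have "a * h < (d + a - v) * (n * (d + 1) - (n - a) * v)"
      using cond f_ge by (auto simp: a_def)
    also have "\<dots> \<le> f * (n * (d + 1) - (n - a) * gap R t)"
      using f_ge assms(4) by (intro mult_le_mono diff_le_mono2) auto
    \<comment> \<open>Rotations outside \<open>G\<close> overlap in at least \<open>f + 1\<close>
      columns; comparison with the total overlap \<open>a * card U\<close> bounds
      \<open>card G\<close> from below.\<close>
    also have "n * (d + 1) - (n - a) * gap R t \<le> card G"
    proof -
      have G: "G \<subseteq> {..<n}" "finite G" by (auto simp: G_def)
      have "(\<Sum>s<n. f + (if s \<in> G then 0 else 1)) \<le> (\<Sum>s<n. y s)"
      proof (intro sum_mono)
        fix s assume "s \<in> {..<n}"
        then show "f + (if s \<in> G then 0 else 1) \<le> y s"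
          using f_le[of s] by (auto simp: G_def)
      qed
      also have "\<dots> = a * card U"
        unfolding y_def a_def U_def by (rule sum_card_rot_Int[OF A_subset covered_subset])
      also have "(\<Sum>s<n. f + (if s \<in> G then 0 else 1)) = n * f + (n - card G)"
        using G by (simp add: sum.distrib sum.If_cases card_Diff_subset Diff_eq[symmetric])
      finally have "n * f + (n - card G) \<le> a * (n - gap R t)"
        by (simp add: U_def card_covered)
      moreover have "card G \<le> n" using card_mono[OF _ G(1)] by simp
      ultimately have "int n * int f + int n - int (card G) \<le> int a * (int n - int (gap R t))"
        using gap_le[of R t] by (metis add_diff_eq of_nat_add of_nat_diff of_nat_le_iff of_nat_mult)
      moreover have "int f = int d + int a - int (gap R t)" using d_eq by linarith
      ultimately have "int n * (int d + 1) - (int n - int a) * int (gap R t) \<le> int (card G)"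
        by (simp add: algebra_simps)
      moreover have diff: "int (n - a) = int n - int a" using card_A_le[of r] by (simp add: a_def of_nat_diff)
      ultimately have "int (n * (d + 1)) - int ((n - a) * gap R t) \<le> int (card G)"
        unfolding of_nat_mult of_nat_add of_nat_1 diff by simp
      then show ?thesis by linarith
    qed
    finally have less: "a * h < f * card G" by simp
    let ?H = "heavy R t"
    show thesis
    proof (cases "h < card ?H")
      case True
      have "?H \<subseteq> heavy (insert r R) (?t s0)"
      proof
        fix j assume "j \<in> ?H"
        then have "2 \<le> card (column R t j)" by (simp add: heavy_def)
        also have "\<dots> \<le> card (column (insert r R) (?t s0) j)"
          using assms(1,2) by (intro card_mono) (auto simp: finite_column column_update)
        finally show "j \<in> heavy (insert r R) (?t s0)" by (simp add: heavy_def)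
      qed
      then have "h < card (heavy (insert r R) (?t s0))"
        using True card_mono[OF fin_heavy] by (meson less_le_trans)
      then show thesis using that[OF gap_G[OF \<open>s0 \<in> G\<close>]] by auto
    next
      case False
      \<comment> \<open>Otherwise the rotations in \<open>G\<close> would meet the at most
        \<open>h\<close> heavy columns \<open>f * card G\<close> times in all, although each column
        is met by only \<open>a\<close> rotations.\<close>
      have "\<exists>s\<in>G. \<exists>j\<in>rot n s (A r) \<inter> U. j \<notin> ?H"
      proof (rule ccontr)
        assume "\<not> ?thesis"
        then have "rot n s (A r) \<inter> U = rot n s (A r) \<inter> ?H" if "s \<in> G" for s
          using that heavy_subset[of R t] by (auto simp: U_def)
        then have "(\<Sum>s\<in>G. f) = (\<Sum>s\<in>G. card (rot n s (A r) \<inter> ?H))"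
          by (intro sum.cong) (auto simp: G_def y_def)
        also have "\<dots> \<le> (\<Sum>s<n. card (rot n s (A r) \<inter> ?H))"
          by (intro sum_mono2) (auto simp: G_def)
        also have "\<dots> = a * card ?H"
          unfolding a_def using heavy_subset covered_subset by (intro sum_card_rot_Int A_subset) blast
        finally have "card G * f \<le> a * card ?H" by simp
        also have "\<dots> \<le> a * h" using False by simp
        finally show False using less by (simp add: mult.commute)
      qed
      then obtain s j where s: "s \<in> G" and j: "j \<in> rot n s (A r)" "j \<in> U" "j \<notin> ?H" by blast
      have "column (insert r R) (?t s) j = insert r (column R t j)"
        using column_update[OF assms(2)] j(1) by simp
      moreover have "r \<notin> column R t j" using assms(2) column_subset by blast
      moreover have "finite (column R t j)" using assms(1) by (rule finite_column)
      moreover have "card (column R t j) = 1"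
      proof -
        have "card (column R t j) \<noteq> 0" using j(2) assms(1) by (simp add: U_def covered_def finite_column)
        moreover have "card (column R t j) < 2" using j(3) by (simp add: heavy_def)
        ultimately show ?thesis by linarith
      qed
      ultimately have "card (column (insert r R) (?t s) j) = 2" by simp
      then show thesis using that[OF gap_G[OF s]] by blast
    qed
  qed
qed

end

subsection \<open>Search for a good order of the rows\<close>

text \<open>The number of empty columns to be aimed at. If \<open>n = 4 (d - 1)\<close>, then \<open>d\<close> empty columns are
  harmless, except that three columns with four cells each are an obstacle for \<open>n = 32\<close>.\<close>

definition thr :: "nat \<Rightarrow> nat" where
  "thr n = (if n = 20 \<or> n = 24 \<or> n = 28 then n div 4 + 1 else (n + 3) div 4)"

text \<open>With \<open>thr n + 1\<close> empty columns, the greedy estimate fails for the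
  exceptional \<open>n\<close> only in configurations with at most this many columns of three or
  more cells, such as sizes 3, 3, 3, 3 for \<open>n = 27\<close> and 4, 4, 4 for
  \<open>n = 31\<close> and \<open>n = 32\<close>.\<close>

definition heavy_bound :: "nat \<Rightarrow> nat" where
  "heavy_bound n = (if n < 31 then 4 else 3)"

text \<open>Orders of the rows after which \<open>thr n + 1\<close> empty columns remain, but still suffice: the last row can
  be placed such that more than \<open>heavy_bound n\<close> columns contain several cells or some column contains
  exactly two, and unless \<open>n = 32\<close> local optimality bounds the number of cells in columns with several.\<close>

definition exceptional :: "nat \<Rightarrow> nat list \<Rightarrow> bool" where
  "exceptional n as =
    (let d = thr n + 1; h = heavy_bound n; a = last as; v = squeezes n (butlast as) in
      (n = 27 \<or> n = 30 \<or> n = 31 \<or> n = 32) \<and> squeezes n as \<le> d \<and>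
      (h < d + a - v \<or> a * h < (d + a - v) * (n * (d + 1) - (n - a) * v)) \<and>
      (n = 32 \<or> 2 * (\<Sum>a\<leftarrow>as. a * (n - d - a) div (n - a)) < n + 4))"

lemma exceptional_code [code]:
  "exceptional n as =
    (if n = 27 \<or> n = 30 \<or> n = 31 \<or> n = 32 then
      let d = thr n + 1; h = heavy_bound n; a = last as; v = squeezes n (butlast as) in
      if squeezes n as \<le> d then
        if (if h < d + a - v then True else a * h < (d + a - v) * (n * (d + 1) - (n - a) * v)) then
          if n = 32 then True else 2 * (\<Sum>a\<leftarrow>as. a * (n - d - a) div (n - a)) < n + 4
        else False
      else False
    else False)"
  by (simp only: exceptional_def Let_def if_bool_eq_disj simp_thms) blast

definition good :: "nat \<Rightarrow> nat list \<Rightarrow> bool" where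
  "good n as = (if squeezes n as \<le> thr n then True else exceptional n as)"

text \<open>A list of row sizes that is not good is repaired by moving a single entry, in the list
  or in its reverse. Any good permutation will do, because the rows may be placed in any
  order.\<close>

fun insert_good :: "nat \<Rightarrow> nat \<Rightarrow> nat list \<Rightarrow> nat list \<Rightarrow> bool" where
  "insert_good n x ys [] = good n (ys @ [x])"
| "insert_good n x ys (z # zs) = (if good n (ys @ x # z # zs) then True else insert_good n x (ys @ [z]) zs)"

fun move_good :: "nat \<Rightarrow> nat list \<Rightarrow> nat list \<Rightarrow> bool" where
  "move_good n ys [] = False"
| "move_good n ys (z # zs) = (if insert_good n z [] (ys @ zs) then True else move_good n (ys @ [z]) zs)"

definition reorder_good :: "nat \<Rightarrow> nat list \<Rightarrow> bool" where
  "reorder_good n as = (if move_good n [] as then True else move_good n [] (rev as))"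

text \<open>\<open>search n t a m v as\<close> runs through the nonincreasing lists of positive numbers at most \<open>a\<close>
  with sum \<open>m\<close>, appended to the reverse of \<open>as\<close>. Here \<open>v\<close> is the value of \<^const>\<open>squeezes\<close> at the
  latter, and a branch is cut off as soon as \<open>v * n < t * (m + n)\<close>, which forces the final value below \<open>t\<close>.\<close>

function search :: "nat \<Rightarrow> nat \<Rightarrow> nat \<Rightarrow> nat \<Rightarrow> nat \<Rightarrow> nat list \<Rightarrow> bool" where
  "search n t a m v as =
    (if a = 0 then True
     else if search n t (a - 1) m v as then
       if m < a then True
       else let w = squeeze n a v in
         if w * n < t * (m - a + n) then True
         else if m = a then reorder_good n (a # as)
         else search n t a (m - a) w (a # as)
     else False)"
  by pat_completeness auto
termination by (relation "measure (\<lambda>(n, t, a, m, v, as). a + m)") auto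

declare search.simps [simp del]

section \<open>Soundness of the search\<close>

lemma insert_good_sound: "insert_good n x ys zs \<Longrightarrow> \<exists>q. mset q = add_mset x (mset ys + mset zs) \<and> good n q"
proof (induction n x ys zs rule: insert_good.induct)
  case (1 n x ys)
  then show ?case by (intro exI[of _ "ys @ [x]"]) simp
next
  case (2 n x ys z zs)
  show ?case
  proof (cases "good n (ys @ x # z # zs)")
    case True
    then show ?thesis by (intro exI[of _ "ys @ x # z # zs"]) simp
  next
    case False
    then show ?thesis using 2 by simp
  qed
qed

lemma move_good_sound: "move_good n ys zs \<Longrightarrow> \<exists>q. mset q = mset ys + mset zs \<and> good n q"
proof (induction n ys zs rule: move_good.induct)
  case (2 n ys z zs)
  show ?case
  proof (cases "insert_good n z [] (ys @ zs)")
    case True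
    then show ?thesis using insert_good_sound[of n z "[]" "ys @ zs"] by simp
  next
    case False
    then show ?thesis using 2 by simp
  qed
qed simp

lemma reorder_good_sound: "reorder_good n as \<Longrightarrow> \<exists>q. mset q = mset as \<and> good n q"
  using move_good_sound[of n "[]" as] move_good_sound[of n "[]" "rev as"]
  by (auto simp: reorder_good_def split: if_splits)

text \<open>The inequality is an invariant: while \<open>v\<close> is at least \<open>t\<close>, a
  step with \<open>a\<close> lowers \<open>v * n\<close> by at least \<open>t * a\<close>, just as
  the right-hand side drops by \<open>t * a\<close>. Once \<open>v\<close> is below \<open>t\<close>
  it stays there.\<close>

lemma fold_squeeze_less:
  assumes "0 < n" "v * n < t * (sum_list q + n)"
  shows "fold (squeeze n) q v < t"
  using assms(2)
proof (induction q arbitrary: v)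
  case Nil
  then show ?case by simp
next
  case (Cons a q)
  have w: "squeeze n a v * n \<le> v * (n - a)" by (simp add: squeeze_def)
  have "0 < t" using Cons.prems by (cases t) auto
  then have pos: "0 < t * (sum_list q + n)" using assms(1) by simp
  consider "n < a" | "v < t" | "t \<le> v" "a \<le> n" by linarith
  then have "squeeze n a v * n < t * (sum_list q + n)"
  proof cases
    case 1
    then show ?thesis using pos by (simp add: squeeze_def)
  next
    case 2
    have "squeeze n a v * n \<le> v * n" using w by (meson diff_le_self le_trans mult_le_mono2)
    also have "\<dots> < t * n" using 2 assms(1) by simp
    also have "\<dots> \<le> t * (sum_list q + n)" by simp
    finally show ?thesis .
  next
    case 3
    have "squeeze n a v * n + t * a \<le> v * (n - a) + v * a"
      using w 3(1) by (intro add_mono) auto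
    also have "\<dots> = v * n" using 3(2) by (simp flip: distrib_left)
    also have "\<dots> < t * (sum_list q + n) + t * a" using Cons.prems by (simp add: algebra_simps)
    finally show ?thesis by simp
  qed
  then show ?case using Cons.IH by simp
qed

text \<open>The head of \<open>q\<close> is either below \<open>a\<close>, which is the first
  recursive call, or equal to \<open>a\<close>; then the cut-off, a completed list or the second
  call decides. After a cut-off every continuation is good in the given order.\<close>

lemma search_sound:
  assumes "search n t a m v as" "0 < n" "t = thr n + 1" "v = squeezes n (rev as)"
    and "sorted_wrt (\<ge>) q" "\<forall>x\<in>set q. 0 < x \<and> x \<le> a" "sum_list q = m" "0 < m"
  shows "\<exists>p. mset p = mset as + mset q \<and> good n p"
  using assms
proof (induction n t a m v as arbitrary: q rule: search.induct)
  case (1 n t a m v as)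
  from "1.prems"(7,8) obtain x q' where q: "q = x # q'" by (cases q) auto
  have x: "0 < x" "x \<le> a" using "1.prems"(6) q by auto
  have srch: "search n t (a - 1) m v as"
    using "1.prems"(1) x by (subst (asm) search.simps) (simp split: if_splits)
  show ?case
  proof (cases "x = a")
    case False
    have "\<forall>y\<in>set q. 0 < y \<and> y \<le> a - 1"
      using "1.prems"(5,6) q False x by fastforce
    then show ?thesis using "1.IH"(1)[of q] "1.prems" srch x by simp
  next
    case True
    let ?w = "squeeze n a v"
    have m: "m = a + sum_list q'" using "1.prems"(7) q True by simp
    have w: "?w = squeezes n (rev (a # as))" by (simp add: squeezes_snoc "1.prems"(4))
    have "?w * n < t * (m - a + n) \<or> (if m = a then reorder_good n (a # as) else search n t a (m - a) ?w (a # as))"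
      using "1.prems"(1) x m by (subst (asm) search.simps) (auto simp: Let_def split: if_splits)
    then consider "?w * n < t * (m - a + n)" | "m = a" "reorder_good n (a # as)"
      | "m \<noteq> a" "\<not> ?w * n < t * (m - a + n)" "search n t a (m - a) ?w (a # as)" by (auto split: if_splits)
    then show ?thesis
    proof cases
      case 1
      then have "fold (squeeze n) q' ?w < t"
        using "1.prems"(2) m by (intro fold_squeeze_less) auto
      then have "squeezes n (rev as @ q) \<le> thr n"
        by (simp add: squeezes_def q True "1.prems"(3,4))
      then show ?thesis by (intro exI[of _ "rev as @ q"]) (simp add: good_def)
    next
      case 2
      then have "q' = []" using m "1.prems"(6) q by (cases q') auto
      then show ?thesis using reorder_good_sound[OF 2(2)] q True by simp
    next
      case 3
      have "\<exists>p. mset p = mset (a # as) + mset q' \<and> good n p"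
        using 3 x m "1.prems" q w srch
        by (intro "1.IH"(2)) (auto intro: less_le_trans[OF _ member_le_sum_list])
      then show ?thesis using q True by simp
    qed
  qed
qed

text \<open>Carries a good order of the row sizes back to an order of the rows themselves.\<close>

lemma ex_map_eq_mset:
  assumes "mset p = image_mset f M"
  shows "\<exists>xs. mset xs = M \<and> map f xs = p"
  using assms
proof (induction p arbitrary: M)
  case (Cons a p)
  then obtain M' x where "M = add_mset x M'" "f x = a" "image_mset f M' = mset p"
    using msed_map_invR[of f M a "mset p"] by auto
  moreover from this Cons.IH[of M'] obtain xs where "mset xs = M'" "map f xs = p" by auto
  ultimately show ?case by (intro exI[of _ "x # xs"]) simp
qed simp

lemma ex_good_order:
  fixes f :: "'a \<Rightarrow> nat"
  assumes "search n (thr n + 1) n n n []" "0 < n" "finite R" "\<And>r. r \<in> R \<Longrightarrow> 0 < f r" "(\<Sum>r\<in>R. f r) = n"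
  obtains rs where "distinct rs" "set rs = R" "good n (map f rs)"
proof -
  let ?q = "rev (sorted_list_of_multiset (image_mset f (mset_set R)))"
  have mset_q: "mset ?q = image_mset f (mset_set R)" by simp
  have "sum_list ?q = n"
    using assms(5) by (metis mset_q sum_mset_sum_list sum_unfold_sum_mset)
  moreover have "\<forall>x\<in>set ?q. 0 < x" using assms(3,4) by auto
  moreover have "\<forall>x\<in>set ?q. x \<le> sum_list ?q" using member_le_sum_list by blast
  moreover have "sorted_wrt (\<ge>) ?q" by (simp add: sorted_wrt_rev sorted_sorted_list_of_multiset)
  ultimately obtain p where "mset p = mset ?q" "good n p"
    using search_sound[OF assms(1,2) refl, of ?q] assms(2) by (auto simp: squeezes_def)
  then obtain rs where rs: "mset rs = mset_set R" "map f rs = p"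
    using ex_map_eq_mset[of p f "mset_set R"] mset_q by auto
  have "distinct rs"
    using rs(1) assms(3) by (metis distinct_count_atmost_1 count_mset_set(3) count_mset_set(1) finite_set_mset_mset_set set_mset_mset)
  moreover have "set rs = R" using rs(1) assms(3) by (metis finite_set_mset_mset_set set_mset_mset)
  ultimately show thesis using that \<open>good n p\<close> rs(2) by blast
qed

lemma search_2_26: "\<forall>n\<in>set [2..<27]. search n (thr n + 1) n n n []" by code_simp
lemma search_27_29: "\<forall>n\<in>set [27, 28, 29]. search n (thr n + 1) n n n []" by code_simp
lemma search_30: "search 30 (thr 30 + 1) 30 30 30 []" by code_simp
lemma search_31: "search 31 (thr 31 + 1) 31 31 31 []" by code_simp
lemma search_32: "search 32 (thr 32 + 1) 32 32 32 []" by code_simp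
lemma search_33: "search 33 (thr 33 + 1) 33 33 33 []" by code_simp
lemma search_34: "search 34 (thr 34 + 1) 34 34 34 []" by code_simp
lemma search_37: "search 37 (thr 37 + 1) 37 37 37 []" by code_simp

lemma search_holds:
  assumes "2 \<le> n \<and> n \<le> 34 \<or> n = 37"
  shows "search n (thr n + 1) n n n []"
proof -
  consider "2 \<le> n \<and> n < 27" | "n = 27 \<or> n = 28 \<or> n = 29"
    | "n = 30" | "n = 31" | "n = 32" | "n = 33" | "n = 34" | "n = 37"
    using assms by linarith
  then show ?thesis
  proof cases
    case 1
    then have "n \<in> set [2..<27]" by (simp only: set_upt atLeastLessThan_iff)
    with search_2_26 show ?thesis by (rule bspec)
  next
    case 2
    then have "n \<in> set [27, 28, 29]" by simp
    with search_27_29 show ?thesis by (rule bspec)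
  qed (simp_all only: search_30 search_31 search_32 search_33 search_34 search_37)
qed

subsection \<open>Arrangement of the chosen cells\<close>

context row_family
begin

text \<open>If no arrangement gets down to \<open>thr n\<close> empty columns, the order found by
  the search must be exceptional, and its last row is placed by
  \<open>ex_last_shift\<close>.\<close>

lemma ex_arrangement:
  assumes "search n (thr n + 1) n n n []" "finite R" "\<And>r. r \<in> R \<Longrightarrow> A r \<noteq> {}" "(\<Sum>r\<in>R. card (A r)) = n"
  shows "\<exists>t. gap R t \<le> thr n \<or>
    (n = 27 \<or> n = 30 \<or> n = 31 \<or> n = 32) \<and> gap R t = thr n + 1 \<and>
    (heavy_bound n < card (heavy R t) \<or> (\<exists>j. card (column R t j) = 2)) \<and>
    (n = 32 \<or> 2 * (\<Sum>j\<in>heavy R t. card (column R t j)) < n + 4)"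
proof (cases "\<exists>t. gap R t \<le> thr n")
  case True
  then show ?thesis by blast
next
  case False
  \<comment> \<open>This makes every arrangement with \<open>thr n + 1\<close> empty columns
    optimal, as both \<open>ex_last_shift\<close> and \<open>heavy_part_le\<close> require.\<close>
  then have min: "thr n + 1 \<le> gap R t" for t
  proof -
    have "\<not> gap R t \<le> thr n" using False by blast
    then show ?thesis by simp
  qed
  have "0 < card (A r)" if "r \<in> R" for r using assms(3)[OF that] by (simp add: card_gt_0_iff)
  then obtain rs where rs: "distinct rs" "set rs = R" "good n (map (\<lambda>r. card (A r)) rs)"
    using ex_good_order[OF assms(1) n_pos assms(2) _ assms(4)] by blast
  let ?p = "map (\<lambda>r. card (A r)) rs"
  obtain t0 where "gap R t0 \<le> squeezes n ?p" using ex_gap_le[OF rs(1)] rs(2) by blast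
  with min[of t0] have "\<not> squeezes n ?p \<le> thr n" by linarith
  then have exc: "exceptional n ?p" using rs(3) by (simp add: good_def)
  define d where "d = thr n + 1"
  define v where "v = squeezes n (butlast ?p)"
  have "rs \<noteq> []" using assms(4) n_pos rs(2) by auto
  then obtain rs' r where rs': "rs = rs' @ [r]" by (metis append_butlast_last_id)
  define a where "a = card (A r)"
  have R: "insert r (set rs') = R" "r \<notin> set rs'" "distinct rs'" using rs rs' by auto
  have v: "v = squeezes n (map (\<lambda>r. card (A r)) rs')" by (simp add: v_def rs')
  have E: "n = 27 \<or> n = 30 \<or> n = 31 \<or> n = 32" "squeezes n ?p \<le> d"
    "heavy_bound n < d + a - v \<or> a * heavy_bound n < (d + a - v) * (n * (d + 1) - (n - a) * v)"
    "n = 32 \<or> 2 * (\<Sum>a\<leftarrow>?p. a * (n - d - a) div (n - a)) < n + 4"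
    using exc unfolding exceptional_def Let_def by (simp_all add: d_def v a_def rs')
  obtain t where "gap (set rs') t \<le> v" using ex_gap_le[OF R(3)] v by blast
  moreover have "squeeze n a v \<le> d" using E(2) by (simp add: rs' squeezes_snoc v a_def)
  ultimately obtain s where s: "gap R (t(r := s)) = d"
    "heavy_bound n < card (heavy R (t(r := s))) \<or> (\<exists>j. card (column R (t(r := s)) j) = 2)"
    using ex_last_shift[of "set rs'" r d t v "heavy_bound n"] R E(3) min
    unfolding a_def d_def by (metis List.finite_set)
  let ?t = "t(r := s)"
  have "2 * (\<Sum>j\<in>heavy R ?t. card (column R ?t j)) < n + 4" if "n \<noteq> 32"
  proof -
    have "finite (heavy R ?t)" using heavy_subset finite_covered finite_subset by blast
    \<comment> \<open>The cells in heavy columns are counted by rows, each of which is bounded by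
      local optimality.\<close>
    then have "(\<Sum>j\<in>heavy R ?t. card (column R ?t j)) = (\<Sum>r\<in>R. card (rot n (?t r) (A r) \<inter> heavy R ?t))"
      by (rule sum_card_column[OF assms(2)])
    also have "\<dots> \<le> (\<Sum>r\<in>R. card (A r) * (n - d - card (A r)) div (n - card (A r)))"
    proof (rule sum_mono)
      have "d \<le> gap R t'" for t' using min by (simp add: d_def)
      then show "card (rot n (?t r) (A r) \<inter> heavy R ?t) \<le> card (A r) * (n - d - card (A r)) div (n - card (A r))"
        if "r \<in> R" for r
        using s(1) assms(2) that by (rule heavy_part_le) (simp add: d_def)
    qed
    also have "\<dots> = (\<Sum>a\<leftarrow>?p. a * (n - d - a) div (n - a))"
      using rs by (simp add: sum_list_distinct_conv_sum_set comp_def)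
    finally show ?thesis using E(4) that by linarith
  qed
  then show ?thesis using E(1) s unfolding d_def by blast
qed

lemma ex_packable_columns:
  assumes "search n (thr n + 1) n n n []" "n \<le> 34 \<or> n = 37"
    and "finite R" "R \<subseteq> {..<n}" "\<And>r. r \<in> R \<Longrightarrow> A r \<noteq> {}" "(\<Sum>r\<in>R. card (A r)) = n"
  shows "\<exists>t. packable n (column R t) (covered R t)"
proof -
  obtain t where t: "gap R t \<le> thr n \<or>
    (n = 27 \<or> n = 30 \<or> n = 31 \<or> n = 32) \<and> gap R t = thr n + 1 \<and>
    (heavy_bound n < card (heavy R t) \<or> (\<exists>j. card (column R t j) = 2)) \<and>
    (n = 32 \<or> 2 * (\<Sum>j\<in>heavy R t. card (column R t j)) < n + 4)"
    using ex_arrangement[OF assms(1,3,5,6)] by blast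
  let ?B = "column R t" and ?J = "covered R t"
  define d where "d = gap R t"
  define mass where "mass = (\<Sum>j\<in>heavy R t. card (?B j))"
  have fin: "finite ?J" by simp
  have sub: "?B j \<subseteq> {..<n}" for j using column_subset assms(4) by blast
  have ne: "?B j \<noteq> {}" if "j \<in> ?J" for j using that by (simp add: covered_def)
  have pos: "1 \<le> card (?B j)" if "j \<in> ?J" for j
    using ne[OF that] finite_column[OF assms(3), of t j] by (simp add: Suc_le_eq card_gt_0_iff)
  have sum: "(\<Sum>j\<in>?J. card (?B j)) = n" using sum_card_column_covered[OF assms(3)] assms(6) by simp
  have card_J: "card ?J + d = n" using card_covered_le[of R t] by (simp add: d_def gap_def)
  have heavy: "{j \<in> ?J. 2 \<le> card (?B j)} = heavy R t"
    using heavy_subset[of R t] by (auto simp: heavy_def)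
  have two: "j \<in> ?J" if "card (?B j) = 2" for j
    using that heavy_subset[of R t] by (auto simp: heavy_def)
  have mass_le: "mass + card {j \<in> ?J. 3 \<le> card (?B j)} \<le> 2 * d"
    using heavy_mass_le[OF fin pos sum card_J] by (simp add: mass_def heavy)
  have pack: "packable n ?B ?J" if "2 * mass < n + 4"
    and "\<And>s e k. 3 \<le> s \<Longrightarrow> k * (s - 1) \<le> e \<Longrightarrow> e + (s - 1) \<le> d \<Longrightarrow>
      s * (e + k) < n \<or> e + (s - 1) = d \<and> k < h"
    and "h = 0 \<or> h < card (heavy R t) \<or> (\<exists>j\<in>?J. card (?B j) = 2)" for h
    using packable_criterion[OF fin n_pos sub ne sum card_J, of h] that by (simp add: mass_def heavy)
  \<comment> \<open>With no column of three cells each pair contributes excess 1, so there are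
    exactly \<open>d\<close> pairs.\<close>
  have pack_pairs: "packable n ?B ?J" if "\<And>j. j \<in> ?J \<Longrightarrow> card (?B j) < 3" "n = 4 * (d - 1)" "3 \<le> d"
  proof (rule packable_pairs[OF fin sub])
    show "card (?B j) = 1 \<or> card (?B j) = 2" if "j \<in> ?J" for j
      using pos[OF that] \<open>\<And>j. j \<in> ?J \<Longrightarrow> card (?B j) < 3\<close>[OF that] by linarith
    then have "(\<Sum>j\<in>?J. card (?B j)) = (\<Sum>j\<in>?J. 1 + (if card (?B j) = 2 then 1 else 0))"
      by (intro sum.cong) fastforce+
    also have "\<dots> = card ?J + card {j \<in> ?J. card (?B j) = 2}"
      using fin by (simp only: sum.distrib sum.inter_filter[symmetric]) simp
    finally show "card {j \<in> ?J. card (?B j) = 2} = d" using sum card_J by simp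
  qed (use sum that in auto)
  \<comment> \<open>One column with three or more cells improves the bound on \<open>mass\<close> by
    1, which for \<open>n = 4 * (d - 1)\<close> is enough to get
    \<open>2 * mass < n + 4\<close>.\<close>
  have some_big: "mass + 1 \<le> 2 * d" if "\<not> (\<forall>j\<in>?J. card (?B j) < 3)"
  proof -
    have "{j \<in> ?J. 3 \<le> card (?B j)} \<noteq> {}" using that by (auto simp: not_less)
    then have "card {j \<in> ?J. 3 \<le> card (?B j)} \<noteq> 0" using fin by simp
    then show ?thesis using mass_le by linarith
  qed
  \<comment> \<open>In \<open>regular\<close> the bound \<open>mass \<le> 2 * d\<close> suffices. In
    \<open>pairs\<close> and \<open>pairs32\<close> one has \<open>n = 4 * (d - 1)\<close>, and
    either all columns are small or \<open>some_big\<close> applies. In \<open>special\<close> the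
    bound on \<open>mass\<close> comes from local optimality.\<close>
  consider (regular) "4 * d < n + 4" "d \<le> 10"
    | (pairs) "n = 4 * (d - 1)" "(n, d) \<in> {(20, 6), (24, 7), (28, 8)}"
    | (pairs32) "n = 32" "d = 9" "3 < card (heavy R t) \<or> (\<exists>j. card (?B j) = 2)"
    | (special) "(n, d, heavy_bound n) \<in> {(27, 8, 4), (30, 9, 4), (31, 9, 3)}" "2 * mass < n + 4"
        "heavy_bound n < card (heavy R t) \<or> (\<exists>j. card (?B j) = 2)"
  proof -
    have t': "d \<le> thr n \<or> (n = 27 \<or> n = 30 \<or> n = 31 \<or> n = 32) \<and> d = thr n + 1 \<and>
        (heavy_bound n < card (heavy R t) \<or> (\<exists>j. card (?B j) = 2)) \<and> (n = 32 \<or> 2 * mass < n + 4)"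
      using t by (simp only: d_def mass_def)
    consider "d \<le> (n + 3) div 4" | "n = 20 \<or> n = 24 \<or> n = 28" "d = n div 4 + 1"
      | "n = 27 \<or> n = 30 \<or> n = 31 \<or> n = 32" "d = thr n + 1"
        "heavy_bound n < card (heavy R t) \<or> (\<exists>j. card (?B j) = 2)" "n = 32 \<or> 2 * mass < n + 4"
    proof (cases "d \<le> thr n")
      case True
      then show ?thesis using that(1,2) by (cases "d \<le> (n + 3) div 4") (auto simp: thr_def split: if_splits)
    next
      case False
      then show ?thesis using t' that(3) by blast
    qed
    then show thesis
    proof cases
      case 1
      then show thesis using assms(2) by (intro regular) auto
    next
      case 2
      then show thesis by (intro pairs) auto
    next
      case 3
      show thesis
      proof (cases "n = 32")
        case True
        then show thesis using 3 by (intro pairs32) (auto simp: thr_def heavy_bound_def)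
      next
        case False
        then show thesis using 3 by (intro special) (auto simp: thr_def heavy_bound_def)
      qed
    qed
  qed
  then have "packable n ?B ?J"
  proof cases
    case regular
    show ?thesis
      using mass_le regular arith_regular[OF regular(2,1)] by (intro pack[of 0]) auto
  next
    case pairs
    show ?thesis
    proof (cases "\<forall>j\<in>?J. card (?B j) < 3")
      case True
      then show ?thesis using pairs by (intro pack_pairs) auto
    next
      case False
      have "(n, d, 0) \<in> set [(20, 6, 0), (24, 7, 0), (28, 8, 0), (27, 8, 4), (30, 9, 4), (31, 9, 3), (32, 9, 3)]"
        using pairs(2) by auto
      then show ?thesis
        using some_big[OF False] pairs arith_exceptional[of n d 0] by (intro pack[of 0]) auto
    qed
  next
    case pairs32
    show ?thesis
    proof (cases "\<forall>j\<in>?J. card (?B j) < 3")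
      case True
      then show ?thesis using pairs32 by (intro pack_pairs) auto
    next
      case False
      show ?thesis
        using some_big[OF False] pairs32 arith_exceptional[of n d 3] two by (intro pack[of 3]) auto
    qed
  next
    case special
    have "(n, d, heavy_bound n) \<in> set [(20, 6, 0), (24, 7, 0), (28, 8, 0), (27, 8, 4), (30, 9, 4), (31, 9, 3), (32, 9, 3)]"
      using special(1) by auto
    then show ?thesis
      using special arith_exceptional[of n d "heavy_bound n"] two by (intro pack[of "heavy_bound n"]) blast+
  qed
  then show ?thesis by blast
qed

end

text \<open>Packing separates cells of different columns; cells within one column come from
  different rows and are rotated together.\<close>

lemma ex_distinct_rows:
  assumes "search n (thr n + 1) n n n []" "0 < n" "n \<le> 34 \<or> n = 37" "S \<subseteq> square n" "card S = n"
  shows "\<exists>t s. inj_on (\<lambda>(k, r). (r + s ((k + t r) mod n)) mod n) S"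
proof -
  define A where "A r = {k. (k, r) \<in> S}" for r
  interpret row_family n A
    using assms(2,4) by unfold_locales (auto simp: A_def square_def)
  define R where "R = snd ` S"
  have S: "finite S" using assms(2,5) card.infinite by fastforce
  have R: "finite R" "R \<subseteq> {..<n}" "\<And>r. r \<in> R \<Longrightarrow> A r \<noteq> {}"
    using S assms(4) by (auto simp: R_def A_def square_def)
  have "S = prod.swap ` (SIGMA r:R. A r)" by (force simp: R_def A_def image_iff)
  then have "card S = card (SIGMA r:R. A r)" by (simp add: card_image)
  also have "\<dots> = (\<Sum>r\<in>R. card (A r))" using R(1) by (intro card_SigmaI) auto
  finally have "(\<Sum>r\<in>R. card (A r)) = n" using assms(5) by simp
  from ex_packable_columns[OF assms(1,3) R this]
  obtain t s where ts: "disjoint_family_on (\<lambda>j. rot n (s j) (column R t j)) (covered R t)"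
    by (auto simp: packable_def)
  have "inj_on (\<lambda>(k, r). (r + s ((k + t r) mod n)) mod n) S"
  proof (rule inj_onI, clarsimp)
    fix k r k' r'
    assume kr: "(k, r) \<in> S" "(k', r') \<in> S"
      and eq: "(r + s ((k + t r) mod n)) mod n = (r' + s ((k' + t r') mod n)) mod n"
    have less: "k < n" "r < n" "k' < n" "r' < n" using kr assms(4) by (auto simp: square_def)
    define j j' where "j = (k + t r) mod n" and "j' = (k' + t r') mod n"
    have "r \<in> column R t j" "r' \<in> column R t j'"
      using kr by (force simp: column_def R_def A_def rot_def j_def j'_def)+
    then have "(r + s j) mod n \<in> rot n (s j) (column R t j)" "(r' + s j') mod n \<in> rot n (s j') (column R t j')"
      "j \<in> covered R t" "j' \<in> covered R t"
      by (auto simp: rot_def covered_def)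
    then have jj: "j = j'" using ts eq unfolding disjoint_family_on_def j_def[symmetric] j'_def[symmetric]
      by (metis IntI empty_iff)
    then have "r = r'" using eq less add_mod_inj[of r n r' "s j"] by (simp add: j_def j'_def)
    then show "k = k' \<and> r = r'" using jj less add_mod_inj[of k n k' "t r"] by (simp add: j_def j'_def)
  qed
  then show ?thesis by blast
qed

section \<open>From the chosen cells to the shuffles\<close>

lemma digit_less: "0 < n \<Longrightarrow> digit n x k < n"
  by (simp add: digit_def)

lemma sum_digits: "(\<Sum>k<m. digit n x k * n ^ k) = x mod n ^ m"
proof (induction m)
  case (Suc m)
  then show ?case
    using mod_mult2_eq[of x "n ^ m" n] by (simp add: digit_def mult.commute)
qed simp

lemma equi_square_perform:
  assumes "equi_square n P" "HV_shuffle n \<sigma>"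
  shows "equi_square n (perform n \<sigma> P)"
proof -
  have bij: "bij_betw \<sigma> (square n) (square n)" using assms(2) by (rule bij_betw_HV_shuffle)
  then have img: "\<sigma> ` square n = square n" by (rule bij_betw_imp_surj_on)
  have "perform n \<sigma> P q < n" if "q \<in> square n" for q
  proof -
    obtain p where "p \<in> square n" "q = \<sigma> p" using img \<open>q \<in> square n\<close> by blast
    then show ?thesis using assms(1) perform_shuffle[OF assms(2)] by (simp add: equi_square_def)
  qed
  moreover have "card {q \<in> square n. perform n \<sigma> P q = d} = n" if "d < n" for d
  proof -
    have "{q \<in> \<sigma> ` square n. perform n \<sigma> P q = d} = \<sigma> ` {p \<in> square n. P p = d}"
      using perform_shuffle[OF assms(2)] by auto
    then have "{q \<in> square n. perform n \<sigma> P q = d} = \<sigma> ` {p \<in> square n. P p = d}"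
      unfolding img .
    also have "card \<dots> = card {p \<in> square n. P p = d}"
      using bij by (intro card_image) (auto simp: bij_betw_def inj_on_def)
    finally show ?thesis using assms(1) that by (simp add: equi_square_def)
  qed
  ultimately show ?thesis by (simp add: equi_square_def)
qed

text \<open>A digit is wanted by at most \<open>n\<close> values of \<open>k\<close> and occurs in
  exactly \<open>n\<close> cells, so distinct cells can be assigned digit by digit.\<close>

lemma ex_cells_with_digits:
  assumes "equi_square n P" "\<And>k. k < n \<Longrightarrow> f k < n"
  shows "\<exists>c. inj_on c {..<n} \<and> c ` {..<n} \<subseteq> square n \<and> (\<forall>k<n. P (c k) = f k)"
proof -
  let ?K = "\<lambda>d. {k. k < n \<and> f k = d}" and ?C = "\<lambda>d. {p \<in> square n. P p = d}"
  have ex: "\<exists>g. g ` ?K d \<subseteq> ?C d \<and> inj_on g (?K d)" if "d < n" for d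
  proof -
    have "card (?K d) \<le> card {..<n}" by (intro card_mono) auto
    also have "\<dots> = card (?C d)" using assms(1) that by (simp add: equi_square_def)
    finally show ?thesis by (intro card_le_inj) (auto simp: square_def)
  qed
  define g where "g d = (SOME h. h ` ?K d \<subseteq> ?C d \<and> inj_on h (?K d))" for d
  have g: "g d ` ?K d \<subseteq> ?C d \<and> inj_on (g d) (?K d)" if "d < n" for d
    unfolding g_def by (rule someI_ex[OF ex[OF that]])
  define c where "c k = g (f k) k" for k
  have c: "c k \<in> square n \<and> P (c k) = f k" if "k < n" for k
  proof -
    have "g (f k) ` ?K (f k) \<subseteq> ?C (f k)" using g[OF assms(2)[OF that]] by blast
    then have "g (f k) k \<in> ?C (f k)" using that by blast
    then show ?thesis unfolding c_def by blast
  qed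
  have "inj_on c {..<n}"
  proof (rule inj_onI)
    fix k k' assume k: "k \<in> {..<n}" "k' \<in> {..<n}" "c k = c k'"
    then have "P (c k) = f k" "P (c k') = f k'" using c[of k] c[of k'] k(1,2) by auto
    then have "f k = f k'" using k(3) by simp
    then have "g (f k) k = g (f k) k'" "k \<in> ?K (f k)" "k' \<in> ?K (f k)"
      using k by (simp_all add: c_def)
    moreover have "inj_on (g (f k)) (?K (f k))" using g[OF assms(2)[of k]] k(1) by blast
    ultimately show "k = k'" by (meson inj_onD)
  qed
  with c show ?thesis by blast
qed

lemma two_shuffles:
  assumes "search n (thr n + 1) n n n []" "0 < n" "n \<le> 34 \<or> n = 37" "equi_square n P" "y < n ^ n"
  shows "\<exists>\<sigma> \<tau>. HV_shuffle n \<sigma> \<and> HV_shuffle n \<tau> \<and>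
    H_indirection n (perform n \<tau> (perform n \<sigma> P)) x = y"
proof -
  obtain c where c: "inj_on c {..<n}" "c ` {..<n} \<subseteq> square n" "\<And>k. k < n \<Longrightarrow> P (c k) = digit n y k"
    using ex_cells_with_digits[OF assms(4), of "digit n y"] assms(2) digit_less by blast
  obtain t s where ts: "inj_on (\<lambda>(k, r). (r + s ((k + t r) mod n)) mod n) (c ` {..<n})"
    using ex_distinct_rows[OF assms(1-3) c(2)] c(1) by (auto simp: card_image)
  define \<sigma> where "\<sigma> = V_move n (\<lambda>j. int (s j)) \<circ> H_move n (\<lambda>r. int (t r))"
  define row where "row k = snd (\<sigma> (c k))" for k
  define col where "col k = fst (\<sigma> (c k))" for k
  have sig: "\<sigma> (k, r) = ((k + t r) mod n, (r + s ((k + t r) mod n)) mod n)" for k r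
  proof -
    have "nat ((int i + int j) mod int n) = (i + j) mod n" for i j
      by (metis nat_int of_nat_add of_nat_mod)
    then show ?thesis by (simp add: \<sigma>_def H_move_def V_move_def)
  qed
  have "(\<lambda>(k, r). (r + s ((k + t r) mod n)) mod n) = snd \<circ> \<sigma>"
    by (auto simp: sig)
  then have "inj_on (snd \<circ> \<sigma>) (c ` {..<n})" using ts by simp
  from comp_inj_on[OF c(1) this] have inj: "inj_on row {..<n}"
    by (simp add: row_def[abs_def] comp_def)
  have HV: "HV_shuffle n \<sigma>" by (auto simp: HV_shuffle_def \<sigma>_def)
  have sq: "\<sigma> (c k) \<in> square n" if "k < n" for k
    using that c(2) bij_betw_HV_shuffle[OF HV] by (auto simp: bij_betw_def)
  \<comment> \<open>After the first shuffle the chosen cells lie in distinct rows, so row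
    \<open>r\<close> determines the index \<open>k\<close> of its chosen cell. The row is rotated to
    bring this cell into column \<open>k\<close>, and \<open>b\<close> then moves it to the row
    given by the input digit.\<close>
  define a where "a r = (let k = inv_into {..<n} row r in int k - int (col k))" for r
  define b where "b k = int (digit n x k) - int (row k)" for k
  define \<tau> where "\<tau> = V_move n b \<circ> H_move n a"
  have HV': "HV_shuffle n \<tau>" by (auto simp: HV_shuffle_def \<tau>_def)
  have tau: "\<tau> (\<sigma> (c k)) = (k, digit n x k)" if "k < n" for k
  proof -
    have "a (row k) = int k - int (col k)" using inj that by (simp add: a_def)
    moreover have "\<sigma> (c k) = (col k, row k)" by (simp add: row_def col_def)
    ultimately show ?thesis
      using that digit_less[OF assms(2), of x k]
      by (simp add: \<tau>_def H_move_def V_move_def b_def)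
  qed
  have "perform n \<tau> (perform n \<sigma> P) (k, digit n x k) = digit n y k" if "k < n" for k
    using that perform_shuffle[OF HV' sq[OF that], of "perform n \<sigma> P"] perform_shuffle[OF HV, of "c k" P] c(2,3)
    by (auto simp: tau)
  then have "H_indirection n (perform n \<tau> (perform n \<sigma> P)) x = (\<Sum>k<n. digit n y k * n ^ k)"
    by (simp add: H_indirection_def)
  also have "\<dots> = y" using assms(5) by (simp add: sum_digits)
  finally show ?thesis using HV HV' by blast
qed

lemma standard_mode_reaches:
  assumes "search n (thr n + 1) n n n []" "0 < n" "n \<le> 34 \<or> n = 37"
    and "length xs = length ys" "equi_square n P" "\<forall>y\<in>set ys. y < n ^ n"
  shows "\<exists>\<sigma>s. length \<sigma>s = 2 * length xs \<and> (\<forall>\<sigma>\<in>set \<sigma>s. HV_shuffle n \<sigma>) \<and> standard_mode n P \<sigma>s xs = ys"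
  using assms(4-)
proof (induction xs ys arbitrary: P rule: list_induct2)
  case Nil
  then show ?case by simp
next
  case (Cons x xs y ys)
  obtain \<sigma> \<tau> where st: "HV_shuffle n \<sigma>" "HV_shuffle n \<tau>"
    "H_indirection n (perform n \<tau> (perform n \<sigma> P)) x = y"
    using two_shuffles[OF assms(1-3) Cons.prems(1), of y x] Cons.prems(2) by auto
  have "equi_square n (perform n \<tau> (perform n \<sigma> P))"
    using Cons.prems(1) st by (intro equi_square_perform)
  with Cons.IH[of "perform n \<tau> (perform n \<sigma> P)"] Cons.prems(2)
  obtain \<sigma>s where "length \<sigma>s = 2 * length xs" "\<forall>\<sigma>\<in>set \<sigma>s. HV_shuffle n \<sigma>"
    "standard_mode n (perform n \<tau> (perform n \<sigma> P)) \<sigma>s xs = ys" by auto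
  with st show ?case by (intro exI[of _ "\<sigma> # \<tau> # \<sigma>s"]) (simp add: Let_def)
qed

theorem theoremB:
  fixes n l :: nat and P :: "nat \<times> nat \<Rightarrow> nat" and xs ys :: "nat list"
  assumes "2 \<le> n \<and> n \<le> 34 \<or> n = 37"
    and "l > 0"
    and "equi_square n P"
    and "length xs = l" and "\<forall>x\<in>set xs. x < n ^ n"
    and "length ys = l" and "\<forall>y\<in>set ys. y < n ^ n"
  shows "\<exists>\<sigma>s. length \<sigma>s = 2 * l \<and> (\<forall>\<sigma>\<in>set \<sigma>s. HV_shuffle n \<sigma>) \<and>
               standard_mode n P \<sigma>s xs = ys"
  using standard_mode_reaches[of n xs ys P] search_holds[of n] assms by auto

end
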